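(* Let $g\ge1$ and let $v_1,\ldots,v_n\in V$ be homogeneous of weights $\mathrm{wt}(v_k)$ inserted at $y_1,\ldots,y_n$. Then for every polynomial $p$ with complex coefficients of degree at most $2$, $$\mathcal D^p_{\boldsymbol y}\mathcal F_V(\boldsymbol v,\boldsymbol y)+\sum_{k=1}^np^{(2)}(y_k)\,\mathcal F_V(\ldots;L(1)v_k,y_k;\ldots)\,dy_k=0,$$ where $$\mathcal D^p_{\boldsymbol y}=\sum_{a\in\mathcal I}\left(p(w_a)\partial_{w_a}+p^{(1)}(w_a)\rho_a\partial_{\rho_a}+p^{(2)}(w_a)\rho_a\partial_{w_{-a}}\right)+\sum_{k=1}^n\left(p(y_k)\partial_{y_k}+\mathrm{wt}(v_k)p^{(1)}(y_k)\right).$$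
   Context: $V=(V,Y,\mathbf 1,\omega)$ is a simple vertex operator algebra over $\mathbb C$ of strong CFT type ($V=\bigoplus_{n\ge0}V_n$, $\dim V_n<\infty$, $V_0=\mathbb C\mathbf 1$, $L(1)V_1=0$), isomorphic to its contragredient module $V'$. $Y(\omega,z)=\sum_nL(n)z^{-n-2}$. $\langle\cdot,\cdot\rangle$ is the unique non-degenerate invariant bilinear form on $V$ with $\langle\mathbf 1,\mathbf 1\rangle=1$: $\langle Y(u,z)v,w\rangle=\langle v,Y(e^{zL(1)}(-z^{-2})^{L(0)}u,z^{-1})w\rangle$. $Z^{(0)}(v_1,y_1;\ldots;v_n,y_n)=\langle\mathbf 1,Y(v_1,y_1)\cdots Y(v_n,y_n)\mathbf 1\rangle$, extended to a rational function of the $y_k$. $\mathcal I=\{\pm1,\ldots,\pm g\}$; $w_a$ ($a\in\mathcal I$), $\rho_1,\ldots,\rho_g$ are formal variables, $\rho_{-a}:=\rho_a$ (so $\partial_{\rho_{-a}}=\partial_{\rho_a}$). For each $a=1,\ldots,g$, $\{b_a\}$ is a homogeneous basis of $V$, $\{\overline b_a\}$ its $\langle\cdot,\cdot\rangle$-dual basis, $b_{-a}=\rho_a^{\mathrm{wt}(b_a)}\overline b_a$. Define $$Z_V(\boldsymbol v,\boldsymbol y)=\sum_{b_1,\ldots,b_g}Z^{(0)}(v_1,y_1;\ldots;v_n,y_n;b_1,w_1;b_{-1},w_{-1};\ldots;b_g,w_g;b_{-g},w_{-g}),$$ $\mathcal F_V(\boldsymbol v,\boldsymbol y)=Z_V(\boldsymbol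 v,\boldsymbol y)\prod_kdy_k^{\mathrm{wt}(v_k)}$ (note $L(1)v_k$ has weight $\mathrm{wt}(v_k)-1$). The operators $\partial_{w_a},\partial_{\rho_a},\partial_{y_k}$ act on the coefficient $Z_V$. $p^{(i)}(x)=\frac1{i!}\frac{d^ip}{dx^i}(x)$. *)

theory Defs
  imports
    "HOL-Library.Poly_Mapping"
    "HOL-Library.FuncSet"
    "HOL-Computational_Algebra.Polynomial"
    "HOL-Computational_Algebra.Fraction_Field"
    Complex_Main
begin

section \<open>Rational functions in the insertion points\<close>

text \<open>
  \<open>y k\<close> is the insertion point of \<open>v\<^sub>k\<close> and \<open>w a\<close> that of \<open>b\<^sub>a\<close>.  The linear order on
  the variables has no mathematical meaning; it is what the library requires in order to see that
  the polynomial ring is an integral domain.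
\<close>

datatype var = y nat | w int

hide_const (open) y w

instantiation var :: linorder
begin

fun var_le :: "var \<Rightarrow> var \<Rightarrow> bool" where
  "var_le (var.y j) (var.y k) = (j \<le> k)"
| "var_le (var.y j) (var.w a) = True"
| "var_le (var.w a) (var.y j) = False"
| "var_le (var.w a) (var.w b) = (a \<le> b)"

definition "x \<le> x' \<longleftrightarrow> var_le x x'"
definition "x < x' \<longleftrightarrow> var_le x x' \<and> \<not> var_le x' x" for x x' :: var

instance
proof
  fix a b c :: var
  show "a < b \<longleftrightarrow> a \<le> b \<and> \<not> b \<le> a" by (simp add: less_eq_var_def less_var_def)
  show "a \<le> a" by (cases a) (auto simp: less_eq_var_def)
  show "a \<le> b \<Longrightarrow> b \<le> c \<Longrightarrow> a \<le> c"
    by (cases a; cases b; cases c) (auto simp: less_eq_var_def)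
  show "a \<le> b \<Longrightarrow> b \<le> a \<Longrightarrow> a = b"
    by (cases a; cases b) (auto simp: less_eq_var_def)
  show "a \<le> b \<or> b \<le> a"
    by (cases a; cases b) (auto simp: less_eq_var_def)
qed

end

type_synonym mpoly = "(var \<Rightarrow>\<^sub>0 nat) \<Rightarrow>\<^sub>0 complex"
type_synonym ratfun = "mpoly fract"

definition rat_const :: "complex \<Rightarrow> ratfun" where
  "rat_const c = Fract (Poly_Mapping.single 0 c) 1"

definition rat_var :: "var \<Rightarrow> ratfun" where
  "rat_var x = Fract (Poly_Mapping.single (Poly_Mapping.single x 1) 1) 1"

definition poly_pd :: "var \<Rightarrow> mpoly \<Rightarrow> mpoly" where
  "poly_pd x P = (\<Sum>m\<in>Poly_Mapping.keys P.
     Poly_Mapping.single (m - Poly_Mapping.single x 1) (of_nat (Poly_Mapping.lookup m x) * Poly_Mapping.lookup P m))"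

lemma poly_pd_superset:
  assumes "finite A" "Poly_Mapping.keys P \<subseteq> A"
  shows "poly_pd x P = (\<Sum>m\<in>A.
     Poly_Mapping.single (m - Poly_Mapping.single x 1) (of_nat (Poly_Mapping.lookup m x) * Poly_Mapping.lookup P m))"
  unfolding poly_pd_def
  by (rule sum.mono_neutral_left) (use assms in \<open>auto simp: in_keys_iff\<close>)

lemma poly_pd_zero [simp]: "poly_pd x 0 = 0"
  by (simp add: poly_pd_def)

lemma poly_pd_single:
  "poly_pd x (Poly_Mapping.single m c) =
     Poly_Mapping.single (m - Poly_Mapping.single x 1) (of_nat (Poly_Mapping.lookup m x) * c)"
  by (cases "c = 0") (simp_all add: poly_pd_def)

lemma poly_pd_add: "poly_pd x (P + Q) = poly_pd x P + poly_pd x Q"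
proof -
  let ?A = "Poly_Mapping.keys P \<union> Poly_Mapping.keys Q"
  have "Poly_Mapping.keys (P + Q) \<subseteq> ?A" by (rule keys_add)
  then show ?thesis
    by (simp add: poly_pd_superset[of ?A] lookup_add distrib_left single_add sum.distrib)
qed

lemma poly_pd_sum: "poly_pd x (\<Sum>i\<in>I. f i) = (\<Sum>i\<in>I. poly_pd x (f i))"
  by (induction I rule: infinite_finite_induct) (simp_all add: poly_pd_add)

lemma mpoly_sum_single: "P = (\<Sum>m\<in>Poly_Mapping.keys P. Poly_Mapping.single m (Poly_Mapping.lookup P m))" for P :: mpoly
  by (rule poly_mapping_eqI) (simp add: lookup_sum lookup_single when_def in_keys_iff)

lemma poly_pd_mult_single:
  "poly_pd x (Poly_Mapping.single m c * Poly_Mapping.single k d) =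
     poly_pd x (Poly_Mapping.single m c) * Poly_Mapping.single k d
     + Poly_Mapping.single m c * poly_pd x (Poly_Mapping.single k d)"
proof -
  let ?s = "Poly_Mapping.single x (1::nat)"
  have 1: "(m - ?s) + k = (m + k) - ?s" if "Poly_Mapping.lookup m x \<noteq> 0" for m k :: "var \<Rightarrow>\<^sub>0 nat"
    by (rule poly_mapping_eqI)
       (use that in \<open>auto simp: lookup_add lookup_minus lookup_single when_def\<close>)
  have 2: "m + (k - ?s) = (m + k) - ?s" if "Poly_Mapping.lookup k x \<noteq> 0" for m k :: "var \<Rightarrow>\<^sub>0 nat"
    using 1[OF that, of m] by (simp add: add.commute)
  note step = poly_pd_single mult_single lookup_add
  show ?thesis
  proof (cases "Poly_Mapping.lookup m x = 0")
    case m: True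
    show ?thesis
    proof (cases "Poly_Mapping.lookup k x = 0")
      case True
      with m show ?thesis by (simp add: step)
    next
      case False
      show ?thesis unfolding step 2[OF False] by (simp add: m mult.left_commute)
    qed
  next
    case m: False
    show ?thesis
    proof (cases "Poly_Mapping.lookup k x = 0")
      case True
      then show ?thesis unfolding step 1[OF m] by (simp add: mult.assoc)
    next
      case False
      have "(of_nat (Poly_Mapping.lookup m x + Poly_Mapping.lookup k x) :: complex) * (c * d) =
          of_nat (Poly_Mapping.lookup m x) * c * d + c * (of_nat (Poly_Mapping.lookup k x) * d)"
        by (simp add: algebra_simps)
      then show ?thesis
        unfolding step 1[OF m] 2[OF False] by (simp only: single_add)
    qed
  qed
qed

lemma poly_pd_mult: "poly_pd x (P * Q) = poly_pd x P * Q + P * poly_pd x Q"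
proof -
  define f where "f = (\<lambda>m. Poly_Mapping.single m (Poly_Mapping.lookup P m))"
  define h where "h = (\<lambda>m. Poly_Mapping.single m (Poly_Mapping.lookup Q m))"
  have P: "P = sum f (Poly_Mapping.keys P)" and Q: "Q = sum h (Poly_Mapping.keys Q)"
    unfolding f_def h_def by (rule mpoly_sum_single)+
  have fh: "poly_pd x (f m * h k) = poly_pd x (f m) * h k + f m * poly_pd x (h k)" for m k
    unfolding f_def h_def by (rule poly_pd_mult_single)
  have "poly_pd x (sum f A * sum h B) =
      poly_pd x (sum f A) * sum h B + sum f A * poly_pd x (sum h B)" for A B
    by (simp add: sum_product poly_pd_sum fh sum.distrib)
  from this[of "Poly_Mapping.keys P" "Poly_Mapping.keys Q"] show ?thesis using P Q by simp
qed

lemma fractrel_quotient_rule: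
  fixes D :: "'a::idom \<Rightarrow> 'a"
  assumes "fractrel r s" and mult: "\<And>P Q. D (P * Q) = D P * Q + P * D Q"
  shows "fractrel (case r of (P, Q) \<Rightarrow> (D P * Q - P * D Q, Q * Q))
                  (case s of (P, Q) \<Rightarrow> (D P * Q - P * D Q, Q * Q))"
proof -
  obtain P Q P' Q' where rs: "r = (P, Q)" "s = (P', Q')" by fastforce
  from assms(1) have nz: "Q \<noteq> 0" "Q' \<noteq> 0" and eq: "P * Q' = P' * Q"
    by (auto simp: fractrel_def rs)
  have "D P * Q' + P * D Q' = D P' * Q + P' * D Q"
    using arg_cong[OF eq, of D] by (simp add: mult)
  moreover have "(D P * Q - P * D Q) * (Q' * Q') - (D P' * Q' - P' * D Q') * (Q * Q) =
      Q * Q' * ((D P * Q' + P * D Q') - (D P' * Q + P' * D Q))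
      - (P * Q' - P' * Q) * (Q' * D Q + Q * D Q')"
    by (simp add: algebra_simps)
  ultimately have "(D P * Q - P * D Q) * (Q' * Q') = (D P' * Q' - P' * D Q') * (Q * Q)"
    using eq by simp
  with nz show ?thesis by (simp add: fractrel_def rs)
qed

lemma fractrel_quotient_rule_Fract:
  fixes D :: "'a::idom \<Rightarrow> 'a"
  assumes "Q \<noteq> 0"
  shows "fractrel (case if Q = 0 then (0, 1) else (P, Q) of
                     (P, Q) \<Rightarrow> (D P * Q - P * D Q, Q * Q))
                  (if Q * Q = 0 then (0, 1) else (D P * Q - P * D Q, Q * Q))"
  using assms by (simp add: fractrel_def)

lift_definition rat_pd :: "var \<Rightarrow> ratfun \<Rightarrow> ratfun" is
  "\<lambda>x (P, Q). (poly_pd x P * Q - P * poly_pd x Q, Q * Q)"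
  by (rule fractrel_quotient_rule[OF _ poly_pd_mult])

lemma rat_pd_Fract:
  "Q \<noteq> 0 \<Longrightarrow> rat_pd x (Fract P Q) = Fract (poly_pd x P * Q - P * poly_pd x Q) (Q * Q)"
  by transfer (rule fractrel_quotient_rule_Fract)

section \<open>Formal distributions\<close>

text \<open>
  \<open>S :: dist\<close> stands for the doubly infinite formal sum \<open>\<Sum>\<^sub>e S e \<cdot> x\<^sup>e\<close> over integer exponent
  vectors \<open>e\<close>.  Such sums form a module over the polynomials, but not a ring.
\<close>

type_synonym dist = "(var \<Rightarrow> int) \<Rightarrow> complex"

definition poly_dist :: "mpoly \<Rightarrow> dist" where
  "poly_dist P = (\<lambda>e. \<Sum>m\<in>Poly_Mapping.keys P. if e = (\<lambda>x. int (Poly_Mapping.lookup m x)) then Poly_Mapping.lookup P m else 0)"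

definition dist_mult :: "mpoly \<Rightarrow> dist \<Rightarrow> dist" where
  "dist_mult Q S = (\<lambda>e. \<Sum>m\<in>Poly_Mapping.keys Q. Poly_Mapping.lookup Q m * S (\<lambda>x. e x - int (Poly_Mapping.lookup m x)))"

text \<open>
  If \<open>Q \<cdot> S = P\<close> and \<open>Q' \<cdot> S = P'\<close> then \<open>Q' P = Q Q' S = Q P'\<close>, so the rational function is
  determined by \<open>S\<close>.  In the use below \<open>S\<close> lies in the field of iterated Laurent series
  \<open>\<complex>((x\<^sub>1))\<dots>((x\<^sub>m))\<close>, where \<open>Q \<cdot> S = P\<close> says that \<open>S\<close> is the expansion of \<open>P / Q\<close> in the
  domain \<open>|x\<^sub>1| > \<dots> > |x\<^sub>m|\<close>.
\<close>

definition rational_extension :: "dist \<Rightarrow> ratfun" where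
  "rational_extension S =
     (THE F. \<exists>P Q. Q \<noteq> 0 \<and> F = Fract P Q \<and> dist_mult Q S = poly_dist P)"

section \<open>Vertex operator algebras\<close>

text \<open>\<open>vop V u n\<close> is the mode \<open>u(n)\<close> in \<open>Y(u,z) = \<Sum>\<^sub>n u(n) z\<^bsup>-n-1\<^esup>\<close>.\<close>

record 'v voa_data =
  smul :: "complex \<Rightarrow> 'v \<Rightarrow> 'v"
  vop :: "'v \<Rightarrow> int \<Rightarrow> 'v \<Rightarrow> 'v"
  vac :: 'v
  conf :: 'v

definition L :: "'v voa_data \<Rightarrow> int \<Rightarrow> 'v \<Rightarrow> 'v" where
  "L V n = vop V (conf V) (n + 1)"

definition wt_space :: "'v voa_data \<Rightarrow> int \<Rightarrow> 'v set" where
  "wt_space V h = {v. L V 0 v = smul V (of_int h) v}"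

text \<open>
  \<open>borcherds\<close> is the Jacobi identity, written as the equality of the coefficients of
  \<open>z\<^sub>0\<^bsup>-l-1\<^esup> z\<^sub>1\<^bsup>-m-1\<^esup> z\<^sub>2\<^bsup>-n-1\<^esup>\<close>.  By \<open>truncation\<close> all sums in it have finite support
  (\<open>Sum_any\<close> sums over the support).
\<close>

locale voa = vector_space "smul V" for V :: "'v::ab_group_add voa_data" +
  assumes bilinear_left: "Vector_Spaces.linear (smul V) (smul V) (\<lambda>u. vop V u n v)"
    and bilinear_right: "Vector_Spaces.linear (smul V) (smul V) (vop V u n)"
    and truncation: "\<exists>N. \<forall>n\<ge>N. vop V u n v = 0"
    and vacuum: "vop V (vac V) n v = (if n = -1 then v else 0)"
    and creation: "vop V u (-1) (vac V) = u" "n \<ge> 0 \<Longrightarrow> vop V u n (vac V) = 0"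
    and borcherds:
      "Sum_any (\<lambda>i::nat. smul V ((of_int m :: complex) gchoose i)
          (vop V (vop V u (l + int i) v) (m + n - int i) x)) =
       Sum_any (\<lambda>i::nat. smul V ((-1) ^ i * ((of_int l :: complex) gchoose i))
          (vop V u (m + l - int i) (vop V v (n + int i) x)
           - smul V ((-1) powi l) (vop V v (n + l - int i) (vop V u (m + int i) x))))"
    and virasoro:
      "\<exists>c. \<forall>m n v. L V m (L V n v) - L V n (L V m v) =
         smul V (of_int (m - n)) (L V (m + n) v)
         + (if m + n = 0 then smul V (of_int (m ^ 3 - m) / 12 * c) v else 0)"
    and translation: "vop V (L V (-1) u) n v = smul V (of_int (- n)) (vop V u (n - 1) v)"
    and grading: "span (\<Union>h. wt_space V h) = UNIV"
    and grading_finite: "\<exists>A. finite A \<and> wt_space V h = span A"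
    and grading_bounded: "\<exists>N. \<forall>h<N. wt_space V h = {0}"

definition voa_ideal :: "'v::ab_group_add voa_data \<Rightarrow> 'v set \<Rightarrow> bool" where
  "voa_ideal V I \<longleftrightarrow> module.subspace (smul V) I \<and>
     (\<forall>u n. \<forall>x\<in>I. vop V u n x \<in> I \<and> vop V x n u \<in> I)"

definition simple_voa :: "'v::ab_group_add voa_data \<Rightarrow> bool" where
  "simple_voa V \<longleftrightarrow> (UNIV :: 'v set) \<noteq> {0} \<and>
     (\<forall>I. voa_ideal V I \<longrightarrow> I = {0} \<or> I = UNIV)"

definition strong_CFT_type :: "'v::ab_group_add voa_data \<Rightarrow> bool" where
  "strong_CFT_type V \<longleftrightarrow> (\<forall>h<0. wt_space V h = {0}) \<and>
     wt_space V 0 = module.span (smul V) {vac V} \<and> (\<forall>v\<in>wt_space V 1. L V 1 v = 0)"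

subsection \<open>The contragredient module and invariant forms\<close>

definition wt_component :: "'v::ab_group_add voa_data \<Rightarrow> int \<Rightarrow> 'v \<Rightarrow> 'v" where
  "wt_component V h u = (THE x. \<exists>c. (\<forall>k. c k \<in> wt_space V k) \<and> finite {k. c k \<noteq> 0} \<and>
      Sum_any c = u \<and> x = c h)"

text \<open>
  \<open>opp_vop V u n\<close> is the coefficient of \<open>z\<^bsup>-n-1\<^esup>\<close> in \<open>Y(e\<^bsup>zL(1)\<^esup>(-z\<^bsup>-2\<^esup>)\<^bsup>L(0)\<^esup>u, z\<^bsup>-1\<^esup>)\<close>: for \<open>u\<close> of
  weight \<open>h\<close> the argument is \<open>\<Sum>\<^sub>j (-1)\<^sup>h z\<^bsup>j-2h\<^esup> L(1)\<^sup>ju / j!\<close>, and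
  \<open>Y(x, z\<^bsup>-1\<^esup>) = \<Sum>\<^sub>k x(k) z\<^bsup>k+1\<^esup>\<close>, so that \<open>k = 2h - j - n - 2\<close>.
\<close>

definition opp_vop :: "'v::ab_group_add voa_data \<Rightarrow> 'v \<Rightarrow> int \<Rightarrow> 'v \<Rightarrow> 'v" where
  "opp_vop V u n v = Sum_any (\<lambda>h. Sum_any (\<lambda>j::nat.
     smul V ((-1) powi h / fact j)
       (vop V ((L V 1 ^^ j) (wt_component V h u)) (2 * h - int j - n - 2) v)))"

definition restricted_dual :: "'v::ab_group_add voa_data \<Rightarrow> ('v \<Rightarrow> complex) set" where
  "restricted_dual V = {f. Vector_Spaces.linear (smul V) (*) f \<and>
     finite {h. \<exists>v\<in>wt_space V h. f v \<noteq> 0}}"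

definition contragredient_vop ::
    "'v::ab_group_add voa_data \<Rightarrow> 'v \<Rightarrow> int \<Rightarrow> ('v \<Rightarrow> complex) \<Rightarrow> ('v \<Rightarrow> complex)" where
  "contragredient_vop V u n f = (\<lambda>v. f (opp_vop V u n v))"

definition self_contragredient :: "'v::ab_group_add voa_data \<Rightarrow> bool" where
  "self_contragredient V \<longleftrightarrow> (\<exists>\<phi>. bij_betw \<phi> UNIV (restricted_dual V) \<and>
     (\<forall>u v x. \<phi> (u + v) x = \<phi> u x + \<phi> v x) \<and>
     (\<forall>c v x. \<phi> (smul V c v) x = c * \<phi> v x) \<and>
     (\<forall>u n v. \<phi> (vop V u n v) = contragredient_vop V u n (\<phi> v)))"

definition invariant_form ::
    "'v::ab_group_add voa_data \<Rightarrow> ('v \<Rightarrow> 'v \<Rightarrow> complex) \<Rightarrow> bool" where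
  "invariant_form V B \<longleftrightarrow>
     (\<forall>v. Vector_Spaces.linear (smul V) (*) (\<lambda>u. B u v)) \<and>
     (\<forall>u. Vector_Spaces.linear (smul V) (*) (B u)) \<and>
     (\<forall>u n v x. B (vop V u n v) x = B v (opp_vop V u n x))"

definition nondegenerate :: "('v::zero \<Rightarrow> 'v \<Rightarrow> complex) \<Rightarrow> bool" where
  "nondegenerate B \<longleftrightarrow> (\<forall>u. (\<forall>v. B u v = 0) \<longrightarrow> u = 0) \<and> (\<forall>v. (\<forall>u. B u v = 0) \<longrightarrow> v = 0)"

definition homogeneous_basis :: "'v::ab_group_add voa_data \<Rightarrow> 'v set \<Rightarrow> bool" where
  "homogeneous_basis V S \<longleftrightarrow> \<not> module.dependent (smul V) S \<and> module.span (smul V) S = UNIV \<and>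
     (\<forall>b\<in>S. \<exists>h. b \<in> wt_space V h)"

text \<open>\<open>d b\<close> is the element of the dual basis that corresponds to \<open>b\<close>.\<close>

definition dual_basis :: "('v \<Rightarrow> 'v \<Rightarrow> complex) \<Rightarrow> 'v set \<Rightarrow> ('v \<Rightarrow> 'v) \<Rightarrow> bool" where
  "dual_basis B S d \<longleftrightarrow> (\<forall>b\<in>S. \<forall>b'\<in>S. B b (d b') = (if b = b' then 1 else 0))"

section \<open>Genus zero and genus g correlation functions\<close>

text \<open>
  For a list \<open>(u\<^sub>1,x\<^sub>1), \<dots>, (u\<^sub>m,x\<^sub>m)\<close> of states inserted at distinct variables:
  the formal series \<open>\<langle>1, Y(u\<^sub>1,x\<^sub>1) \<dots> Y(u\<^sub>m,x\<^sub>m) 1\<rangle>\<close> and its extension to a rational function.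
\<close>

definition genus0_series ::
    "'v voa_data \<Rightarrow> ('v \<Rightarrow> 'v \<Rightarrow> complex) \<Rightarrow> ('v \<times> var) list \<Rightarrow> dist" where
  "genus0_series V B xs = (\<lambda>e. if \<forall>x. x \<notin> snd ` set xs \<longrightarrow> e x = 0
     then B (vac V) (foldr (\<lambda>(u, x). vop V u (- e x - 1)) xs (vac V)) else 0)"

definition Z0 :: "'v voa_data \<Rightarrow> ('v \<Rightarrow> 'v \<Rightarrow> complex) \<Rightarrow> ('v \<times> var) list \<Rightarrow> ratfun" where
  "Z0 V B xs = rational_extension (genus0_series V B xs)"

text \<open>
  \<open>Z :: series\<close> stands for the formal power series \<open>\<Sum>\<^sub>m Z m \<cdot> \<rho>\<^sub>1\<^bsup>m 1\<^esup> \<dots> \<rho>\<^sub>g\<^bsup>m g\<^esup>\<close> whose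
  coefficients are rational functions of the insertion points.
\<close>

type_synonym series = "(nat \<Rightarrow> nat) \<Rightarrow> ratfun"

text \<open>
  By linearity the factors \<open>\<rho>\<^sub>a\<^bsup>wt(b\<^sub>a)\<^esup>\<close> of the states \<open>b\<^sub>-\<^sub>a\<close> can be taken out of \<open>Z0\<close>, so
  the coefficient of \<open>\<rho>\<^sup>m\<close> is the (finite) sum over those basis elements \<open>b\<^sub>a\<close> that have
  weight \<open>m a\<close>.
\<close>

definition Z_V :: "'v voa_data \<Rightarrow> ('v \<Rightarrow> 'v \<Rightarrow> complex) \<Rightarrow> (nat \<Rightarrow> 'v set) \<Rightarrow> (nat \<Rightarrow> 'v \<Rightarrow> 'v) \<Rightarrow>
    nat \<Rightarrow> nat \<Rightarrow> (nat \<Rightarrow> 'v) \<Rightarrow> series" where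
  "Z_V V B S d g n v = (\<lambda>m. if \<exists>a. a \<notin> {1..g} \<and> m a \<noteq> 0 then 0 else
     (\<Sum>b \<in> (\<Pi>\<^sub>E a\<in>{1..g}. {b \<in> S a. b \<in> wt_space V (int (m a))}).
        Z0 V B (map (\<lambda>k. (v k, var.y k)) [1..<Suc n] @
          concat (map (\<lambda>a. [(b a, var.w (int a)), (d a (b a), var.w (- int a))]) [1..<Suc g]))))"

text \<open>
  \<open>F :: form\<close> stands for \<open>\<Sum>\<^sub>e F e \<cdot> dy\<^sub>1\<^bsup>e 1\<^esup> \<dots> dy\<^sub>n\<^bsup>e n\<^esup>\<close>.  The weight \<open>h k\<close> of \<open>v k\<close> is an
  explicit argument because \<open>0\<close> (a possible value of \<open>L(1)v\<^sub>k\<close>) is homogeneous of every weight.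
\<close>

type_synonym form = "(nat \<Rightarrow> int) \<Rightarrow> series"

definition F_V :: "'v voa_data \<Rightarrow> ('v \<Rightarrow> 'v \<Rightarrow> complex) \<Rightarrow> (nat \<Rightarrow> 'v set) \<Rightarrow> (nat \<Rightarrow> 'v \<Rightarrow> 'v) \<Rightarrow>
    nat \<Rightarrow> nat \<Rightarrow> (nat \<Rightarrow> 'v) \<Rightarrow> (nat \<Rightarrow> int) \<Rightarrow> form" where
  "F_V V B S d g n v h = (\<lambda>e. if e = (\<lambda>k. if k \<in> {1..n} then h k else 0)
     then Z_V V B S d g n v else (\<lambda>m. 0))"

definition mult_dy :: "nat \<Rightarrow> form \<Rightarrow> form" where
  "mult_dy k F = (\<lambda>e. F (e(k := e k - 1)))"

section \<open>The differential operator\<close>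

text \<open>\<open>\<rho>\<^sub>-\<^sub>a = \<rho>\<^sub>a\<close>, hence the absolute value.\<close>

definition mult_rho :: "int \<Rightarrow> series \<Rightarrow> series" where
  "mult_rho a Z = (let i = nat \<bar>a\<bar> in
     (\<lambda>m. if m i = 0 then 0 else Z (m(i := m i - 1))))"

definition pd_rho :: "int \<Rightarrow> series \<Rightarrow> series" where
  "pd_rho a Z = (let i = nat \<bar>a\<bar> in
     (\<lambda>m. of_nat (m i + 1) * Z (m(i := m i + 1))))"

definition pd_var :: "var \<Rightarrow> series \<Rightarrow> series" where
  "pd_var x Z = (\<lambda>m. rat_pd x (Z m))"

text \<open>\<open>p\<^bsup>(i)\<^esup>(x)\<close>, with the normalisation \<open>1/i!\<close>.\<close>

definition hderiv_at :: "complex poly \<Rightarrow> nat \<Rightarrow> var \<Rightarrow> ratfun" where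
  "hderiv_at p i x = poly (map_poly rat_const (smult (1 / fact i) ((pderiv ^^ i) p))) (rat_var x)"

definition index_set :: "nat \<Rightarrow> int set" where
  "index_set g = {a. a \<noteq> 0 \<and> \<bar>a\<bar> \<le> int g}"

definition D_series :: "complex poly \<Rightarrow> nat \<Rightarrow> nat \<Rightarrow> (nat \<Rightarrow> int) \<Rightarrow> series \<Rightarrow> series" where
  "D_series p g n h Z = (\<lambda>m.
     (\<Sum>a\<in>index_set g.
        hderiv_at p 0 (var.w a) * pd_var (var.w a) Z m
        + hderiv_at p 1 (var.w a) * mult_rho a (pd_rho a Z) m
        + hderiv_at p 2 (var.w a) * mult_rho a (pd_var (var.w (- a)) Z) m)
     + (\<Sum>k\<in>{1..n}.
        hderiv_at p 0 (var.y k) * pd_var (var.y k) Z m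
        + of_int (h k) * hderiv_at p 1 (var.y k) * Z m))"

definition D_form :: "complex poly \<Rightarrow> nat \<Rightarrow> nat \<Rightarrow> (nat \<Rightarrow> int) \<Rightarrow> form \<Rightarrow> form" where
  "D_form p g n h F = (\<lambda>e. D_series p g n h (F e))"

end

theory Submission
  imports Defs
begin

text \<open>
  The differential equation is the global conformal Ward identity, summed over the dual bases.
  For \<open>j \<in> {-1, 0, 1}\<close> the operator \<open>L(j)\<close> annihilates the vacuum, and so does its adjoint
  \<open>L(-j)\<close> with respect to the invariant form.  Hence \<open>\<langle>1, L(j) Y(u\<^sub>1,x\<^sub>1) \<dots> Y(u\<^sub>m,x\<^sub>m) 1\<rangle> = 0\<close>, and
  commuting \<open>L(j)\<close> through the vertex operators gives, for homogeneous \<open>u\<^sub>i\<close> and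
  \<open>p = 1, x, x\<^sup>2\<close>, that the sum over all insertions of \<open>p \<partial>\<^sub>x + wt(u) p' + (p'' / 2) L(1)\<close> applied to the
  correlation function vanishes (lemma \<open>ward_corr\<close>).

  At the insertions \<open>w\<^sub>a\<close> the term with \<open>L(1)\<close> is not a derivative by itself.  In the sum over
  dual bases of weight \<open>m\<close>, adjointness moves \<open>L(1)\<close> at \<open>w\<^sub>a\<close> to \<open>L(-1)\<close> at \<open>w\<^sub>-\<^sub>a\<close> and lowers the
  weight to \<open>m - 1\<close> (lemma \<open>casimir_L_1\<close>).  As \<open>L(-1)\<close> is the derivative in the insertion point and the
  weight is the exponent of \<open>\<rho>\<^sub>a\<close>, this is the term \<open>\<rho>\<^sub>a \<partial>\<close> with respect to \<open>w\<^sub>-\<^sub>a\<close>, and the term with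
  \<open>wt(u) p'\<close> becomes \<open>p' \<rho>\<^sub>a \<partial>\<close> with respect to \<open>\<rho>\<^sub>a\<close>.

  All of this takes place on the level of formal series, where each coefficient is a complex
  number that is multilinear in the states.  The relation \<open>expands\<close> between a series and a rational
  function is compatible with sums, products by polynomials and derivatives, and a series
  expands at most one rational function, so the identity of series implies that of rational
  functions.  For this the series must expand a rational function in the first place
  (theorem \<open>expands_corr\<close>): by locality, multiplication by powers of the differences \<open>x\<^sub>i - x\<^sub>j\<close> allows to
  move any vertex operator next to the vacuum, so that no negative powers of its variable
  remain, and the grading bounds the degree.
\<close>

section \<open>Formal distributions that expand rational functions\<close>

lemma mpoly_induct [case_names single add]:
  assumes "\<And>m c. R (Poly_Mapping.single m c)" and "\<And>P Q. R P \<Longrightarrow> R Q \<Longrightarrow> R (P + Q)"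
  shows "R (P :: mpoly)"
proof -
  have "R (\<Sum>m\<in>A. Poly_Mapping.single m (Poly_Mapping.lookup P m))" if "finite A" for A
    using that
  proof (induction A)
    case empty
    show ?case using assms(1)[of 0 0] by simp
  qed (simp add: assms)
  from this[OF finite_keys[of P]] show ?thesis using mpoly_sum_single[of P] by simp
qed

lemma dist_mult_superset:
  assumes "finite A" "Poly_Mapping.keys Q \<subseteq> A"
  shows "dist_mult Q S e =
    (\<Sum>m\<in>A. Poly_Mapping.lookup Q m * S (\<lambda>x. e x - int (Poly_Mapping.lookup m x)))"
  unfolding dist_mult_def
  by (rule sum.mono_neutral_left) (use assms in \<open>auto simp: in_keys_iff\<close>)

lemma dist_mult_single:
  "dist_mult (Poly_Mapping.single m c) S e = c * S (\<lambda>x. e x - int (Poly_Mapping.lookup m x))"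
  by (cases "c = 0") (simp_all add: dist_mult_def)

lemma dist_mult_add_left: "dist_mult (P + Q) S e = dist_mult P S e + dist_mult Q S e"
proof -
  let ?A = "Poly_Mapping.keys P \<union> Poly_Mapping.keys Q"
  have "Poly_Mapping.keys (P + Q) \<subseteq> ?A" by (rule keys_add)
  then show ?thesis
    by (simp add: dist_mult_superset[of ?A] lookup_add distrib_right sum.distrib)
qed

lemma dist_mult_zero_left [simp]: "dist_mult 0 S = (\<lambda>e. 0)"
  by (rule ext) (simp add: dist_mult_def)

lemma dist_mult_sum_left: "dist_mult (\<Sum>i\<in>I. f i) S e = (\<Sum>i\<in>I. dist_mult (f i) S e)"
  by (induction I rule: infinite_finite_induct) (simp_all add: dist_mult_add_left)

lemma dist_mult_add_right: "dist_mult Q (\<lambda>e. S e + T e) e = dist_mult Q S e + dist_mult Q T e"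
  by (simp add: dist_mult_def distrib_left sum.distrib)

lemma dist_mult_zero_right [simp]: "dist_mult Q (\<lambda>e. 0) = (\<lambda>e. 0)"
  by (simp add: dist_mult_def fun_eq_iff)

lemma dist_mult_mult: "dist_mult (P * Q) S = dist_mult P (dist_mult Q S)"
proof (rule ext)
  fix e
  show "dist_mult (P * Q) S e = dist_mult P (dist_mult Q S) e"
  proof (induction P rule: mpoly_induct)
    case (single m c)
    show ?case
    proof (induction Q rule: mpoly_induct)
      case (single k d)
      show ?case by (simp add: mult_single dist_mult_single lookup_add algebra_simps)
    next
      case (add P Q)
      then show ?case
        by (simp add: distrib_left dist_mult_add_left dist_mult_single)
    qed
  qed (simp add: distrib_right dist_mult_add_left)
qed

lemma dist_mult_commute: "dist_mult P (dist_mult Q S) = dist_mult Q (dist_mult P S)"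
  by (simp flip: dist_mult_mult add: mult.commute)

text \<open>
  The unit for the action of polynomials: it reduces statements on \<^const>\<open>poly_dist\<close> to statements
  on \<^const>\<open>dist_mult\<close>.
\<close>

definition one_dist :: dist where
  "one_dist e = (if \<forall>x. e x = 0 then 1 else 0)"

lemma poly_dist_eq: "poly_dist P = dist_mult P one_dist"
  by (rule ext) (auto simp: poly_dist_def dist_mult_def one_dist_def fun_eq_iff intro!: sum.cong)

lemma poly_dist_zero [simp]: "poly_dist 0 = (\<lambda>e. 0)"
  by (simp add: poly_dist_eq)

lemma dist_mult_poly_dist: "dist_mult Q (poly_dist P) = poly_dist (Q * P)"
  by (simp add: poly_dist_eq dist_mult_mult)

lemma poly_dist_nat: "poly_dist P (\<lambda>x. int (Poly_Mapping.lookup m x)) = Poly_Mapping.lookup P m"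
proof -
  have "(\<lambda>x. int (Poly_Mapping.lookup m x)) = (\<lambda>x. int (Poly_Mapping.lookup k x)) \<longleftrightarrow> k = m" for k
    by (metis poly_mapping_eqI of_nat_eq_iff)
  then show ?thesis by (simp add: poly_dist_def in_keys_iff)
qed

lemma poly_dist_inject: "poly_dist P = poly_dist Q \<longleftrightarrow> P = Q"
  by (metis poly_dist_nat poly_mapping_eqI)

definition pd_dist :: "var \<Rightarrow> dist \<Rightarrow> dist" where
  "pd_dist x S = (\<lambda>e. of_int (e x + 1) * S (e(x := e x + 1)))"

text \<open>The Leibniz rule for the action of polynomials on series.\<close>

lemma pd_dist_mult:
  "pd_dist x (dist_mult Q S) e = dist_mult (poly_pd x Q) S e + dist_mult Q (pd_dist x S) e"
proof (induction Q rule: mpoly_induct)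
  case (single m c)
  let ?d = "Poly_Mapping.single x (1::nat)"
  let ?l = "\<lambda>z. int (Poly_Mapping.lookup m z)"
  have up: "(\<lambda>z. (e(x := e x + 1)) z - ?l z) = (\<lambda>z. e z - ?l z)(x := e x - ?l x + 1)"
    by auto
  have "of_nat (Poly_Mapping.lookup m x) * S (\<lambda>z. e z - int (Poly_Mapping.lookup (m - ?d) z)) =
      of_nat (Poly_Mapping.lookup m x) * S ((\<lambda>z. e z - ?l z)(x := e x - ?l x + 1))"
  proof (cases "Poly_Mapping.lookup m x = 0")
    case False
    then have "(\<lambda>z. e z - int (Poly_Mapping.lookup (m - ?d) z)) =
        (\<lambda>z. e z - ?l z)(x := e x - ?l x + 1)"
      by (auto simp: lookup_minus lookup_single when_def fun_eq_iff)
    then show ?thesis by (simp only:)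
  qed simp
  then show ?case
    unfolding poly_pd_single dist_mult_single pd_dist_def up by (auto simp: algebra_simps)
next
  case (add P Q)
  moreover have "pd_dist x (dist_mult (P + Q) S) e =
      pd_dist x (dist_mult P S) e + pd_dist x (dist_mult Q S) e"
    by (simp only: pd_dist_def dist_mult_add_left distrib_left)
  ultimately show ?case
    by (simp only: poly_pd_add dist_mult_add_left[of _ _ _ e] add_ac)
qed

lemma pd_one_dist: "pd_dist x one_dist = (\<lambda>e. 0)"
proof (rule ext)
  fix e
  show "pd_dist x one_dist e = 0"
  proof (cases "e x = -1")
    case False
    then have "\<not> (\<forall>z. (e(x := e x + 1)) z = 0)" by (intro notI) (drule spec[of _ x], simp)
    then show ?thesis by (simp only: pd_dist_def one_dist_def if_False mult_zero_right)
  qed (simp add: pd_dist_def)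
qed

lemma pd_poly_dist: "pd_dist x (poly_dist P) = poly_dist (poly_pd x P)"
  unfolding poly_dist_eq by (rule ext) (simp add: pd_dist_mult pd_one_dist)

text \<open>
  The description in \<^const>\<open>rational_extension\<close> as a relation, which can be combined before
  existence and uniqueness are invoked: it is stable under the module operations and under
  derivatives, so an identity between series becomes one between rational functions.
\<close>

definition expands :: "dist \<Rightarrow> ratfun \<Rightarrow> bool" where
  "expands S F \<longleftrightarrow> (\<exists>P Q. Q \<noteq> 0 \<and> F = Fract P Q \<and> dist_mult Q S = poly_dist P)"

lemma expands_unique:
  assumes "expands S F" "expands S G"
  shows "F = G"
proof -
  from assms obtain P Q P' Q' where
    F: "Q \<noteq> 0" "F = Fract P Q" "dist_mult Q S = poly_dist P" and
    G: "Q' \<noteq> 0" "G = Fract P' Q'" "dist_mult Q' S = poly_dist P'"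
    unfolding expands_def by blast
  have "poly_dist (Q' * P) = poly_dist (Q * P')"
    by (metis F(3) G(3) dist_mult_commute dist_mult_poly_dist)
  then show ?thesis using F G by (simp add: poly_dist_inject eq_fract mult.commute)
qed

lemma rational_extension_eqI: "expands S F \<Longrightarrow> rational_extension S = F"
  unfolding rational_extension_def
  by (rule the_equality) (use expands_unique in \<open>auto simp: expands_def\<close>)

lemma expands_zero: "expands (\<lambda>e. 0) 0"
  unfolding expands_def by (intro exI[of _ 0] exI[of _ 1]) (simp add: Zero_fract_def)

lemma expands_add:
  assumes "expands S F" "expands T G"
  shows "expands (\<lambda>e. S e + T e) (F + G)"
proof -
  from assms obtain P Q P' Q' where
    F: "Q \<noteq> 0" "F = Fract P Q" "dist_mult Q S = poly_dist P" and
    G: "Q' \<noteq> 0" "G = Fract P' Q'" "dist_mult Q' T = poly_dist P'"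
    unfolding expands_def by blast
  have "dist_mult (Q * Q') S = poly_dist (Q' * P)" "dist_mult (Q * Q') T = poly_dist (Q * P')"
    using F(3) G(3) by (metis dist_mult_mult dist_mult_commute dist_mult_poly_dist)+
  then have "dist_mult (Q * Q') (\<lambda>e. S e + T e) = poly_dist (P * Q' + P' * Q)"
    by (simp add: fun_eq_iff dist_mult_add_right poly_dist_eq dist_mult_add_left mult.commute)
  then show ?thesis
    unfolding expands_def using F G
    by (intro exI[of _ "P * Q' + P' * Q"] exI[of _ "Q * Q'"]) simp
qed

lemma expands_sum:
  assumes "\<And>i. i \<in> I \<Longrightarrow> expands (S i) (F i)"
  shows "expands (\<lambda>e. \<Sum>i\<in>I. S i e) (\<Sum>i\<in>I. F i)"
  using assms
  by (induction I rule: infinite_finite_induct) (simp_all add: expands_zero expands_add)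

lemma expands_mult:
  assumes "expands S F"
  shows "expands (dist_mult R S) (Fract R 1 * F)"
proof -
  from assms obtain P Q where F: "Q \<noteq> 0" "F = Fract P Q" "dist_mult Q S = poly_dist P"
    unfolding expands_def by blast
  have "dist_mult Q (dist_mult R S) = poly_dist (R * P)"
    using F(3) by (metis dist_mult_commute dist_mult_poly_dist)
  then show ?thesis
    unfolding expands_def using F by (intro exI[of _ "R * P"] exI[of _ Q]) simp
qed

lemma expands_pd:
  assumes "expands S F"
  shows "expands (pd_dist x S) (rat_pd x F)"
proof -
  from assms obtain P Q where F: "Q \<noteq> 0" "F = Fract P Q" "dist_mult Q S = poly_dist P"
    unfolding expands_def by blast
  have "dist_mult (Q * Q) (pd_dist x S) e =
      poly_dist (poly_pd x P * Q - P * poly_pd x Q) e" for e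
  proof -
    have "pd_dist x (dist_mult Q S) = poly_dist (poly_pd x P)"
      using F(3) by (simp add: pd_poly_dist)
    then have "dist_mult (poly_pd x Q) S e + dist_mult Q (pd_dist x S) e = poly_dist (poly_pd x P) e" for e
      by (metis pd_dist_mult)
    then have "dist_mult Q (\<lambda>e. dist_mult (poly_pd x Q) S e + dist_mult Q (pd_dist x S) e) e =
        poly_dist (Q * poly_pd x P) e"
      by (simp add: dist_mult_poly_dist)
    moreover have "dist_mult Q (dist_mult (poly_pd x Q) S) = poly_dist (poly_pd x Q * P)"
      by (metis F(3) dist_mult_commute dist_mult_poly_dist)
    ultimately have "poly_dist (poly_pd x Q * P) e + dist_mult (Q * Q) (pd_dist x S) e =
        poly_dist (Q * poly_pd x P) e"
      by (simp add: dist_mult_add_right dist_mult_mult)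
    moreover have "poly_dist (poly_pd x Q * P) e +
        poly_dist (poly_pd x P * Q - P * poly_pd x Q) e = poly_dist (Q * poly_pd x P) e"
      unfolding poly_dist_eq dist_mult_add_left[symmetric]
      by (simp add: algebra_simps)
    ultimately show ?thesis by (metis add_left_cancel)
  qed
  then show ?thesis
    unfolding expands_def using F
    by (intro exI[of _ "poly_pd x P * Q - P * poly_pd x Q"] exI[of _ "Q * Q"])
       (auto simp: rat_pd_Fract)
qed

text \<open>
  The condition on the variables is there because an exponent vector of a distribution may
  involve infinitely many variables, while a monomial of a polynomial may not.
\<close>

lemma finite_support_poly_dist:
  assumes fin: "finite {e. S e \<noteq> 0}"
    and nonneg: "\<And>e x. S e \<noteq> 0 \<Longrightarrow> e x \<ge> 0"
    and vars: "\<And>e. S e \<noteq> 0 \<Longrightarrow> finite {x. e x \<noteq> 0}"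
  shows "\<exists>P. S = poly_dist P"
proof -
  define A where "A = {e. S e \<noteq> 0}"
  define mon where "mon e = Abs_poly_mapping (\<lambda>x. nat (e x))" for e :: "var \<Rightarrow> int"
  define P where "P = (\<Sum>e\<in>A. Poly_Mapping.single (mon e) (S e))"
  have mon: "(\<lambda>x. int (Poly_Mapping.lookup (mon e) x)) = e" if "e \<in> A" for e
  proof -
    have "{x. nat (e x) \<noteq> 0} \<subseteq> {x. e x \<noteq> 0}" by auto
    then have "finite {x. nat (e x) \<noteq> 0}"
      using vars[of e] that by (auto simp: A_def intro: finite_subset)
    then have "Poly_Mapping.lookup (mon e) = (\<lambda>x. nat (e x))"
      unfolding mon_def by (rule Abs_poly_mapping_inverse[OF CollectI])
    then show ?thesis using nonneg[of e] that by (auto simp: A_def)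
  qed
  have "poly_dist P e = S e" for e
  proof -
    have "poly_dist P e = (\<Sum>e'\<in>A. S e' * (if e = e' then 1 else 0))"
      unfolding P_def poly_dist_eq dist_mult_sum_left
    proof (rule sum.cong)
      fix e' assume e': "e' \<in> A"
      have "one_dist (\<lambda>x. e x - int (Poly_Mapping.lookup (mon e') x)) = (if e = e' then 1 else 0)"
        using fun_cong[OF mon[OF e']] by (auto simp: one_dist_def fun_eq_iff)
      then show "dist_mult (Poly_Mapping.single (mon e') (S e')) one_dist e =
          S e' * (if e = e' then 1 else 0)"
        by (simp add: dist_mult_single)
    qed simp
    also have "\<dots> = (if e \<in> A then S e else 0)"
      using fin by (simp add: A_def if_distrib[of "(*) _"] cong: if_cong)
    finally show ?thesis by (simp add: A_def)
  qed
  then show ?thesis by (intro exI[of _ P]) auto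
qed

section \<open>Commutators, locality and weights\<close>

context voa
begin

lemma module_hom_left: "module_hom (smul V) (smul V) (\<lambda>u. vop V u n x)"
  using bilinear_left by (simp add: linear_iff_module_hom)

lemma module_hom_right: "module_hom (smul V) (smul V) (vop V u n)"
  using bilinear_right by (simp add: linear_iff_module_hom)

lemmas vop_scale_left = module_hom.scale[OF module_hom_left]
  and vop_zero_left [simp] = module_hom.zero[OF module_hom_left]
  and vop_scale_right = module_hom.scale[OF module_hom_right]
  and vop_zero_right [simp] = module_hom.zero[OF module_hom_right]

lemmas L_add = module_hom.add[OF module_hom_right, of "conf V" "j + 1" for j, folded L_def]
  and L_scale = module_hom.scale[OF module_hom_right, of "conf V" "j + 1" for j, folded L_def]
  and L_sum = module_hom.sum[OF module_hom_right, of "conf V" "j + 1" for j, folded L_def]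
  and L_zero [simp] = module_hom.zero[OF module_hom_right, of "conf V" "j + 1" for j, folded L_def]

lemma gchoose_int: "(of_int (int k) :: complex) gchoose i = of_nat (k choose i)"
  by (simp add: binomial_gbinomial)

text \<open>
  The Jacobi identity for \<open>l = 0\<close>.  For a nonnegative mode of \<open>u\<close> the sum is finite
  whatever the states are, since the binomial coefficients vanish.
\<close>

lemma commutator:
  "vop V u (int k) (vop V v n x) - vop V v n (vop V u (int k) x) =
     (\<Sum>i\<le>k. smul V (of_nat (k choose i)) (vop V (vop V u (int i) v) (int k + n - int i) x))"
proof -
  let ?r = "\<lambda>i::nat. smul V ((-1) ^ i * ((of_int 0 :: complex) gchoose i))
          (vop V u (int k + 0 - int i) (vop V v (n + int i) x)
           - smul V ((-1) powi 0) (vop V v (n + 0 - int i) (vop V u (int k + int i) x)))"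
  have "Sum_any ?r = (\<Sum>i\<in>{0}. ?r i)"
    by (rule Sum_any.expand_superset) (auto intro: ccontr simp: gbinomial_0_left)
  moreover have "Sum_any (\<lambda>i::nat. smul V ((of_int (int k) :: complex) gchoose i)
          (vop V (vop V u (0 + int i) v) (int k + n - int i) x)) =
     (\<Sum>i\<le>k. smul V (of_nat (k choose i)) (vop V (vop V u (int i) v) (int k + n - int i) x))"
    unfolding gchoose_int
    by (subst Sum_any.expand_superset[of "{..k}"]) (auto intro: ccontr)
  ultimately show ?thesis
    using borcherds[of "int k" u 0 v n x] by simp
qed

text \<open>
  The Jacobi identity for \<open>l = N\<close> so large that \<open>u(l+i)v = 0\<close> for all \<open>i \<ge> 0\<close>: the coefficients
  of \<open>(z\<^sub>1 - z\<^sub>2)\<^sup>N [Y(u,z\<^sub>1), Y(v,z\<^sub>2)] = 0\<close>.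
\<close>

lemma locality:
  "\<exists>N. \<forall>m n x.
     (\<Sum>i\<le>N. smul V ((-1) ^ i * of_nat (N choose i)) (vop V u (m + int N - int i) (vop V v (n + int i) x))) =
     (\<Sum>i\<le>N. smul V ((-1) ^ i * of_nat (N choose i)) (vop V v (n + int i) (vop V u (m + int N - int i) x)))"
proof -
  obtain N0 where N0: "vop V u j v = 0" if "j \<ge> N0" for j
    using truncation by blast
  define N where "N = nat N0"
  have big: "vop V u (int N + int i) v = 0" for i
    by (rule N0) (simp add: N_def)
  show ?thesis
  proof (intro exI allI)
    fix m n x
    let ?c = "\<lambda>i. (-1 :: complex) ^ i * of_nat (N choose i)"
    have "Sum_any (\<lambda>i::nat. smul V (?c i)
          (vop V u (m + int N - int i) (vop V v (n + int i) x)
           - smul V ((-1) powi int N) (vop V v (n + int N - int i) (vop V u (m + int i) x)))) = 0"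
      using borcherds[of m u "int N" v n x] unfolding big gchoose_int by simp
    also have "Sum_any (\<lambda>i::nat. smul V (?c i)
          (vop V u (m + int N - int i) (vop V v (n + int i) x)
           - smul V ((-1) powi int N) (vop V v (n + int N - int i) (vop V u (m + int i) x)))) =
       (\<Sum>i\<le>N. smul V (?c i)
          (vop V u (m + int N - int i) (vop V v (n + int i) x)
           - smul V ((-1) powi int N) (vop V v (n + int N - int i) (vop V u (m + int i) x))))"
      by (rule Sum_any.expand_superset) (auto intro: ccontr)
    finally have "(\<Sum>i\<le>N. smul V (?c i) (vop V u (m + int N - int i) (vop V v (n + int i) x))) =
       (\<Sum>i\<le>N. smul V (?c i * (-1) ^ N) (vop V v (n + int N - int i) (vop V u (m + int i) x)))"
      by (simp add: scale_right_diff_distrib sum_subtractf)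
    also have "\<dots> = (\<Sum>i\<le>N. smul V (?c (N - i) * (-1) ^ N)
        (vop V v (n + int N - int (N - i)) (vop V u (m + int (N - i)) x)))"
      by (rule sum.reindex_bij_witness[of _ "\<lambda>i. N - i" "\<lambda>i. N - i"]) auto
    also have "\<dots> = (\<Sum>i\<le>N. smul V (?c i) (vop V v (n + int i) (vop V u (m + int N - int i) x)))"
    proof (rule sum.cong)
      fix i assume i: "i \<in> {..N}"
      have "(-1 :: complex) ^ (N - i) * (-1) ^ N = (-1) ^ i"
      proof -
        have "(-1 :: complex) ^ (N - i) * (-1) ^ N = (-1) ^ (2 * (N - i) + i)"
        proof -
          have "N - i + N = 2 * (N - i) + i" using i by simp
          then show ?thesis by (simp only: flip: power_add)
        qed
        then show ?thesis by (simp add: power_add power_mult)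
      qed
      moreover have "N choose (N - i) = N choose i"
        using i binomial_symmetric[of i N] by simp
      ultimately have "?c (N - i) * (-1) ^ N = ?c i" by (simp add: mult_ac)
      moreover have "n + int N - int (N - i) = n + int i" "m + int (N - i) = m + int N - int i"
        using i by auto
      ultimately show "smul V (?c (N - i) * (-1) ^ N)
          (vop V v (n + int N - int (N - i)) (vop V u (m + int (N - i)) x)) =
        smul V (?c i) (vop V v (n + int i) (vop V u (m + int N - int i) x))"
        by (simp only:)
    qed simp
    finally show "(\<Sum>i\<le>N. smul V (?c i) (vop V u (m + int N - int i) (vop V v (n + int i) x))) =
      (\<Sum>i\<le>N. smul V (?c i) (vop V v (n + int i) (vop V u (m + int N - int i) x)))" .
  qed
qed

lemma wt_space_add: "u \<in> wt_space V k \<Longrightarrow> v \<in> wt_space V k \<Longrightarrow> u + v \<in> wt_space V k"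
  by (simp add: wt_space_def L_add scale_right_distrib)

lemma wt_space_scale: "u \<in> wt_space V k \<Longrightarrow> smul V c u \<in> wt_space V k"
  by (simp add: wt_space_def L_scale mult.commute)

lemma zero_wt_space [simp]: "0 \<in> wt_space V k"
  by (simp add: wt_space_def)

lemma wt_space_diff: "u \<in> wt_space V k \<Longrightarrow> v \<in> wt_space V k \<Longrightarrow> u - v \<in> wt_space V k"
  using wt_space_add[of u k "smul V (-1) v"] wt_space_scale[of v k "-1"] by simp

lemma L_m1_commutator:
  "L V (-1) (vop V v n x) = smul V (of_int (- n)) (vop V v (n - 1) x) + vop V v n (L V (-1) x)"
proof -
  have "L V (-1) (vop V v n x) - vop V v n (L V (-1) x) = vop V (L V (-1) v) n x"
    using commutator[of "conf V" 0 v n x] by (simp add: L_def)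
  then show ?thesis by (simp add: translation diff_eq_eq)
qed

lemma L_0_commutator:
  assumes "v \<in> wt_space V k"
  shows "L V 0 (vop V v n x) = smul V (of_int (k - n - 1)) (vop V v n x) + vop V v n (L V 0 x)"
proof -
  have "L V 0 (vop V v n x) - vop V v n (L V 0 x) =
      vop V (L V (-1) v) (n + 1) x + vop V (L V 0 v) n x"
    using commutator[of "conf V" 1 v n x] by (simp add: L_def add.commute)
  also have "\<dots> = smul V (of_int (- (n + 1)) + of_int k) (vop V v n x)"
    using assms by (simp only: translation wt_space_def mem_Collect_eq vop_scale_left
        scale_left_distrib add_diff_cancel_right')
  also have "of_int (- (n + 1)) + of_int k = (of_int (k - n - 1) :: complex)"
    by simp
  finally show ?thesis by (simp only: diff_eq_eq)
qed

lemma L_1_commutator: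
  assumes "v \<in> wt_space V k"
  shows "L V 1 (vop V v n x) = smul V (of_int (2 * k - n - 2)) (vop V v (n + 1) x)
    + vop V (L V 1 v) n x + vop V v n (L V 1 x)"
proof -
  have "L V 1 (vop V v n x) - vop V v n (L V 1 x) =
      vop V (L V (-1) v) (n + 2) x + smul V 2 (vop V (L V 0 v) (n + 1) x) + vop V (L V 1 v) n x"
    using commutator[of "conf V" 2 v n x]
    by (simp add: L_def numeral_2_eq_2 add_ac)
  also have "\<dots> = smul V (of_int (- (n + 2)) + 2 * of_int k) (vop V v (n + 1) x) + vop V (L V 1 v) n x"
  proof -
    have "n + 2 - 1 = n + 1" by simp
    then show ?thesis
      using assms by (simp only: translation wt_space_def mem_Collect_eq vop_scale_left
          scale_left_distrib scale_scale)
  qed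
  also have "of_int (- (n + 2)) + 2 * of_int k = (of_int (2 * k - n - 2) :: complex)"
    by simp
  finally show ?thesis by (simp only: diff_eq_eq)
qed

lemma wt_space_vop:
  assumes "u \<in> wt_space V k" "x \<in> wt_space V l"
  shows "vop V u n x \<in> wt_space V (k + l - n - 1)"
proof -
  have "L V 0 (vop V u n x) = smul V (of_int (k - n - 1) + of_int l) (vop V u n x)"
    using assms(2) unfolding L_0_commutator[OF assms(1)]
    by (simp add: wt_space_def vop_scale_right scale_left_distrib)
  also have "of_int (k - n - 1) + of_int l = (of_int (k + l - n - 1) :: complex)" by simp
  finally show ?thesis by (simp add: wt_space_def)
qed

lemma L_vac: "j \<ge> -1 \<Longrightarrow> L V j (vac V) = 0"
  by (simp add: L_def creation)

lemma vac_wt_space: "vac V \<in> wt_space V 0"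
  by (simp add: wt_space_def L_vac)

lemma conf_eq: "conf V = L V (-2) (vac V)"
  by (simp add: L_def creation)

lemma conf_wt_space: "conf V \<in> wt_space V 2"
proof -
  obtain c where "\<forall>m n v. L V m (L V n v) - L V n (L V m v) =
         smul V (of_int (m - n)) (L V (m + n) v)
         + (if m + n = 0 then smul V (of_int (m ^ 3 - m) / 12 * c) v else 0)"
    using virasoro by blast
  from this[rule_format, of 0 "-2" "vac V"] show ?thesis
    by (simp add: wt_space_def conf_eq L_vac)
qed

lemma L_1_conf: "L V 1 (conf V) = 0"
proof -
  obtain c where "\<forall>m n v. L V m (L V n v) - L V n (L V m v) =
         smul V (of_int (m - n)) (L V (m + n) v)
         + (if m + n = 0 then smul V (of_int (m ^ 3 - m) / 12 * c) v else 0)"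
    using virasoro by blast
  from this[rule_format, of 1 "-2" "vac V"] show ?thesis
    by (simp add: conf_eq L_vac)
qed

lemma wt_space_L: "x \<in> wt_space V k \<Longrightarrow> L V j x \<in> wt_space V (k - j)"
  using wt_space_vop[OF conf_wt_space, of x k "j + 1"] by (simp add: L_def algebra_simps)

text \<open>
  Applying \<open>L(0) - k0\<close> to a linear relation removes its component of weight \<open>k0\<close> and rescales
  the other ones by nonzero factors.
\<close>

lemma wt_spaces_independent:
  assumes "finite K" "\<And>k. k \<in> K \<Longrightarrow> c k \<in> wt_space V k" "(\<Sum>k\<in>K. c k) = 0" "k \<in> K"
  shows "c k = 0"
  using assms
proof (induction K arbitrary: c k)
  case (insert k0 K)
  have sum: "c k0 + (\<Sum>k\<in>K. c k) = 0" using insert by simp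
  have "(\<Sum>k\<in>K. smul V (of_int (k - k0)) (c k)) =
      L V 0 (c k0 + (\<Sum>k\<in>K. c k)) - smul V (of_int k0) (c k0 + (\<Sum>k\<in>K. c k))"
  proof -
    have "L V 0 (c k) = smul V (of_int k) (c k)" if "k \<in> insert k0 K" for k
      using insert.prems(1)[OF that] by (simp add: wt_space_def)
    then show ?thesis
      by (simp add: L_add L_sum scale_sum_right scale_right_distrib scale_left_diff_distrib
          sum_subtractf)
  qed
  also have "\<dots> = 0" by (simp add: sum)
  finally have "(\<Sum>k\<in>K. smul V (of_int (k - k0)) (c k)) = 0" .
  then have "smul V (of_int (k - k0)) (c k) = 0" if "k \<in> K" for k
    using insert.IH[of "\<lambda>k. smul V (of_int (k - k0)) (c k)" k] insert.prems(1) that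
    by (simp add: wt_space_scale)
  then have "c k = 0" if "k \<in> K" for k
    using that insert.hyps(2) by (auto simp: scale_eq_0_iff simp del: of_int_diff)
  then show ?case using sum insert.prems(3) by auto
qed simp

lemma wt_component_homogeneous:
  assumes "u \<in> wt_space V k"
  shows "wt_component V h u = (if h = k then u else 0)"
  unfolding wt_component_def
proof (rule the_equality)
  let ?c = "\<lambda>h. if h = k then u else 0"
  have "Sum_any ?c = (\<Sum>h\<in>{k}. ?c h)"
    by (rule Sum_any.expand_superset) auto
  then have "(\<forall>h. ?c h \<in> wt_space V h) \<and> finite {h. ?c h \<noteq> 0} \<and> Sum_any ?c = u \<and> ?c h = ?c h"
    using assms by simp
  then show "\<exists>c. (\<forall>k. c k \<in> wt_space V k) \<and> finite {k. c k \<noteq> 0} \<and> Sum_any c = u \<and> ?c h = c h"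
    by (intro exI[of _ ?c])
next
  fix x assume "\<exists>c. (\<forall>k. c k \<in> wt_space V k) \<and> finite {k. c k \<noteq> 0} \<and> Sum_any c = u \<and> x = c h"
  then obtain c where c: "\<And>k. c k \<in> wt_space V k" "finite {k. c k \<noteq> 0}" "Sum_any c = u" "x = c h"
    by blast
  define K where "K = insert h (insert k {k. c k \<noteq> 0})"
  have fin: "finite K" using c by (simp add: K_def)
  have "Sum_any c = (\<Sum>j\<in>K. c j)"
    by (rule Sum_any.expand_superset) (auto simp: fin, auto simp: K_def)
  then have "(\<Sum>j\<in>K. c j - (if j = k then u else 0)) = 0"
    using fin c(3) by (simp add: sum_subtractf K_def)
  then have "c h - (if h = k then u else 0) = 0"
    using assms c(1)
    by (intro wt_spaces_independent[OF fin, of "\<lambda>j. c j - (if j = k then u else 0)" h])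
       (auto simp: K_def intro: wt_space_diff)
  then show "x = (if h = k then u else 0)" using c(4) by simp
qed

lemma opp_vop_conf: "opp_vop V (conf V) n x = vop V (conf V) (2 - n) x"
proof -
  let ?t = "\<lambda>h (j::nat). smul V ((-1) powi h / fact j)
       (vop V ((L V 1 ^^ j) (wt_component V h (conf V))) (2 * h - int j - n - 2) x)"
  have L1_zero: "(L V 1 ^^ j) 0 = 0" for j
    by (induction j) auto
  have t: "?t h j = 0" if "h \<noteq> 2 \<or> j \<noteq> 0" for h j
    using that
    by (cases j) (auto simp: wt_component_homogeneous[OF conf_wt_space] L1_zero L_1_conf funpow_Suc_right
        simp del: funpow.simps(2))
  have inner: "Sum_any (?t h) = ?t h 0" for h
  proof -
    have "Sum_any (?t h) = (\<Sum>j\<in>{0}. ?t h j)"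
      by (rule Sum_any.expand_superset) (simp, use t in blast)
    then show ?thesis by simp
  qed
  have "opp_vop V (conf V) n x = Sum_any (\<lambda>h. ?t h 0)"
    unfolding opp_vop_def inner ..
  also have "\<dots> = (\<Sum>h\<in>{2}. ?t h 0)"
    by (rule Sum_any.expand_superset) (simp, use t in blast)
  finally show ?thesis by (simp add: wt_component_homogeneous[OF conf_wt_space])
qed

end

locale voa_form = voa V for V :: "'v::ab_group_add voa_data" +
  fixes B :: "'v \<Rightarrow> 'v \<Rightarrow> complex"
  assumes strong_CFT: "strong_CFT_type V"
    and invariant: "invariant_form V B"
    and nondegenerate: "nondegenerate B"
begin

lemma B_module_hom_left: "module_hom (smul V) (*) (\<lambda>u. B u x)"
  using invariant by (simp add: invariant_form_def linear_iff_module_hom)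

lemma B_module_hom_right: "module_hom (smul V) (*) (B u)"
  using invariant by (simp add: invariant_form_def linear_iff_module_hom)

lemmas B_add_left = module_hom.add[OF B_module_hom_left]
  and B_scale_left = module_hom.scale[OF B_module_hom_left]
  and B_zero_left [simp] = module_hom.zero[OF B_module_hom_left]
  and B_sum_left = module_hom.sum[OF B_module_hom_left]
  and B_diff_right = module_hom.diff[OF B_module_hom_right]
  and B_scale_right = module_hom.scale[OF B_module_hom_right]
  and B_zero_right [simp] = module_hom.zero[OF B_module_hom_right]
  and B_sum_right = module_hom.sum[OF B_module_hom_right]

text \<open>
  Since \<open>\<omega>\<close> is quasiprimary of weight \<open>2\<close>, invariance says that \<open>L(j)\<close> and \<open>L(-j)\<close> are
  adjoint.
\<close>

lemma L_adjoint: "B (L V j u) x = B u (L V (- j) x)"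
proof -
  have "B (vop V (conf V) (j + 1) u) x = B u (opp_vop V (conf V) (j + 1) x)"
    using invariant by (simp add: invariant_form_def)
  moreover have "2 - (j + 1) = - j + 1" by simp
  ultimately show ?thesis by (simp only: opp_vop_conf L_def)
qed

lemma B_vac_L: "j \<le> 1 \<Longrightarrow> B (vac V) (L V j x) = 0"
  using L_adjoint[of "- j" "vac V" x] by (simp add: L_vac)

lemma B_wt_space:
  assumes "u \<in> wt_space V k" "x \<in> wt_space V l" "k \<noteq> l"
  shows "B u x = 0"
proof -
  have "of_int k * B u x = of_int l * B u x"
    using L_adjoint[of 0 u x] assms by (simp add: wt_space_def B_scale_left B_scale_right)
  then show ?thesis using assms(3) by simp
qed

lemma wt_space_negative: "u \<in> wt_space V k \<Longrightarrow> k < 0 \<Longrightarrow> u = 0"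
  using strong_CFT by (auto simp: strong_CFT_type_def)

end

section \<open>Genus zero correlation functions are rational\<close>

lemma mpoly_var_power:
  "(Poly_Mapping.single (Poly_Mapping.single x (1::nat)) c :: mpoly) ^ i =
     Poly_Mapping.single (Poly_Mapping.single x i) (c ^ i)"
proof (induction i)
  case (Suc i)
  have "Poly_Mapping.single x (Suc i) = Poly_Mapping.single x 1 + Poly_Mapping.single x i"
    by (simp flip: single_add)
  with Suc show ?case by (simp add: mult_single)
qed simp

text \<open>The effect of \<open>(x - z)\<^sup>N\<close> on a series, in the form in which locality produces it.\<close>

lemma dist_mult_diff_power:
  fixes x z :: var
  assumes "x \<noteq> z"
  shows "\<exists>Q. Q \<noteq> 0 \<and> (\<forall>S e. dist_mult Q S e = (\<Sum>i\<le>N. (-1) ^ i * of_nat (N choose i) *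
       S (\<lambda>t. e t - (if t = z then int i else 0) - (if t = x then int (N - i) else 0))))"
proof (intro exI conjI allI)
  let ?v = "\<lambda>x c. Poly_Mapping.single (Poly_Mapping.single x (1::nat)) c :: mpoly"
  define Q where "Q = (?v z (-1) + ?v x 1) ^ N"
  show "Q \<noteq> 0"
  proof -
    have "Poly_Mapping.single x (1::nat) \<noteq> Poly_Mapping.single z 1"
      using assms by (metis lookup_single_eq lookup_single_not_eq zero_neq_one)
    then have "Poly_Mapping.lookup (?v z (-1) + ?v x 1) (Poly_Mapping.single x 1) \<noteq> 0"
      by (simp add: lookup_add lookup_single when_def)
    then show ?thesis unfolding Q_def by (metis lookup_zero power_eq_0_iff)
  qed
  fix S e
  have "Q = (\<Sum>i\<le>N. Poly_Mapping.single
      (Poly_Mapping.single z i + Poly_Mapping.single x (N - i)) ((-1) ^ i * of_nat (N choose i)))"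
    unfolding Q_def binomial_ring mpoly_var_power
    by (rule sum.cong) (simp_all add: mult_single mult.commute add.commute flip: single_of_nat)
  then show "dist_mult Q S e = (\<Sum>i\<le>N. (-1) ^ i * of_nat (N choose i) *
       S (\<lambda>t. e t - (if t = z then int i else 0) - (if t = x then int (N - i) else 0)))"
    by (simp add: dist_mult_sum_left dist_mult_single lookup_add lookup_single when_def
        diff_diff_eq if_distrib[of int] eq_commute[of z] eq_commute[of x] cong: if_cong)
qed

lemma dist_mult_nonneg:
  assumes "\<And>e. S e \<noteq> 0 \<Longrightarrow> e x \<ge> 0" "dist_mult Q S e \<noteq> 0"
  shows "e x \<ge> 0"
proof -
  obtain m where "S (\<lambda>t. e t - int (Poly_Mapping.lookup m t)) \<noteq> 0"
    using assms(2) unfolding dist_mult_def by (metis (no_types, lifting) mult_zero_right sum.neutral)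
  from assms(1)[OF this] show ?thesis by simp
qed

context voa_form
begin

text \<open>
  A state assigned to each variable of a list determines a correlation function; with this
  indexing, replacing one of the inserted states is a function update.
\<close>

definition corr :: "var list \<Rightarrow> (var \<Rightarrow> 'v) \<Rightarrow> dist" where
  "corr X f = genus0_series V B (map (\<lambda>x. (f x, x)) X)"

abbreviation mode :: "(var \<Rightarrow> 'v) \<Rightarrow> (var \<Rightarrow> int) \<Rightarrow> var \<Rightarrow> 'v \<Rightarrow> 'v" where
  "mode f e x \<equiv> vop V (f x) (- e x - 1)"

lemma corr_eq:
  "corr X f e =
     (if \<forall>x. x \<notin> set X \<longrightarrow> e x = 0 then B (vac V) (foldr (mode f e) X (vac V)) else 0)"
proof -
  have "foldr (\<lambda>(u, x). vop V u (- e x - 1)) (map (\<lambda>x. (f x, x)) X) = foldr (mode f e) X"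
    by (rule ext) (simp add: foldr_map o_def)
  moreover have "snd ` set (map (\<lambda>x. (f x, x)) X) = set X"
    by force
  ultimately show ?thesis by (simp only: corr_def genus0_series_def)
qed

lemma corr_outside: "t \<notin> set X \<Longrightarrow> e t \<noteq> 0 \<Longrightarrow> corr X f e = 0"
  by (auto simp: corr_eq)

lemma module_hom_foldr:
  assumes "\<And>x. x \<in> set X \<Longrightarrow> module_hom (smul V) (smul V) (A x)"
  shows "module_hom (smul V) (smul V) (foldr A X)"
  using assms
proof (induction X)
  case Nil
  show ?case using module_hom_ident by (simp add: id_def linear_iff_module_hom)
next
  case (Cons x X)
  then have "module_hom (smul V) (smul V) (A x \<circ> foldr A X)"
    by (intro module_hom_compose) auto
  then show ?case by (simp add: o_def)
qed

lemma module_hom_B_foldr: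
  "module_hom (smul V) (*) (\<lambda>w. B u (foldr (\<lambda>x. vop V (f x) (n x)) X w))"
  using module_hom_compose[OF module_hom_foldr[of X "\<lambda>x. vop V (f x) (n x)"] B_module_hom_right[of u]]
  by (simp add: o_def module_hom_right)

lemma locality_corr:
  assumes "distinct (as @ x # z # bs)"
  shows "\<exists>Q. Q \<noteq> 0 \<and>
    dist_mult Q (corr (as @ x # z # bs) f) = dist_mult Q (corr (as @ z # x # bs) f)"
proof -
  obtain N where N: "\<And>m n w.
     (\<Sum>i\<le>N. smul V ((-1) ^ i * of_nat (N choose i)) (vop V (f x) (m + int N - int i) (vop V (f z) (n + int i) w))) =
     (\<Sum>i\<le>N. smul V ((-1) ^ i * of_nat (N choose i)) (vop V (f z) (n + int i) (vop V (f x) (m + int N - int i) w)))"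
    using locality[of "f x" "f z"] by blast
  have "x \<noteq> z" using assms by auto
  then obtain Q where Q: "Q \<noteq> 0"
    "\<And>S e. dist_mult Q S e = (\<Sum>i\<le>N. (-1) ^ i * of_nat (N choose i) *
       S (\<lambda>t. e t - (if t = z then int i else 0) - (if t = x then int (N - i) else 0)))"
    using dist_mult_diff_power[of x z N] by blast
  have "dist_mult Q (corr (as @ x # z # bs) f) e = dist_mult Q (corr (as @ z # x # bs) f) e" for e
  proof (cases "\<forall>t. t \<notin> set (as @ x # z # bs) \<longrightarrow> e t = 0")
    case False
    then obtain t where t: "t \<notin> set (as @ x # z # bs)" "e t \<noteq> 0" by blast
    have "corr (as @ x # z # bs) f e' = 0" "corr (as @ z # x # bs) f e' = 0" if "e' t = e t" for e'
      unfolding corr_eq using t that by auto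
    then show ?thesis unfolding Q(2) using t by (intro sum.cong) auto
  next
    case True
    let ?e = "\<lambda>i t. e t - (if t = z then int i else 0) - (if t = x then int (N - i) else 0)"
    \<comment> \<open>All terms of the two sums share the operators to the left of \<open>x\<close> and \<open>z\<close> (inside \<open>\<Lambda>\<close>)
      and the state \<open>w\<close> to their right.\<close>
    define \<Lambda> where "\<Lambda> y = B (vac V) (foldr (mode f e) as y)" for y
    define w where "w = foldr (mode f e) bs (vac V)"
    have hom: "module_hom (smul V) (*) \<Lambda>"
      unfolding \<Lambda>_def by (rule module_hom_B_foldr)
    have as: "foldr (mode f (?e i)) as = foldr (mode f e) as"
      and bs: "foldr (mode f (?e i)) bs = foldr (mode f e) bs" for i
      by (rule ext, rule foldr_cong; use assms in auto)+
    have xz: "mode f (?e i) x = vop V (f x) ((- e x - 1) + int N - int i)"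
      "mode f (?e i) z = vop V (f z) ((- e z - 1) + int i)" if "i \<le> N" for i
      using assms that by (auto simp: algebra_simps of_nat_diff)
    have supp: "\<forall>t. t \<notin> set (as @ x # z # bs) \<longrightarrow> ?e i t = 0"
       "\<forall>t. t \<notin> set (as @ z # x # bs) \<longrightarrow> ?e i t = 0" for i
      using True by auto
    have 1: "corr (as @ x # z # bs) f (?e i) =
        \<Lambda> (vop V (f x) ((- e x - 1) + int N - int i) (vop V (f z) ((- e z - 1) + int i) w))"
      if "i \<le> N" for i
      unfolding corr_eq if_P[OF supp(1)] foldr_append foldr.simps o_apply as bs xz[OF that] \<Lambda>_def w_def ..
    have 2: "corr (as @ z # x # bs) f (?e i) =
        \<Lambda> (vop V (f z) ((- e z - 1) + int i) (vop V (f x) ((- e x - 1) + int N - int i) w))"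
      if "i \<le> N" for i
      unfolding corr_eq if_P[OF supp(2)] foldr_append foldr.simps o_apply as bs xz[OF that] \<Lambda>_def w_def ..
    have "dist_mult Q (corr (as @ x # z # bs) f) e = \<Lambda> (\<Sum>i\<le>N. smul V ((-1) ^ i * of_nat (N choose i))
        (vop V (f x) ((- e x - 1) + int N - int i) (vop V (f z) ((- e z - 1) + int i) w)))"
      unfolding Q(2) module_hom.sum[OF hom] module_hom.scale[OF hom]
      by (intro sum.cong refl) (simp only: 1 atMost_iff)
    also have "\<dots> = dist_mult Q (corr (as @ z # x # bs) f) e"
      unfolding N Q(2) module_hom.sum[OF hom] module_hom.scale[OF hom]
      by (intro sum.cong refl) (simp only: 2 atMost_iff)
    finally show ?thesis .
  qed
  then show ?thesis using Q(1) by blast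
qed

lemma move_to_end_corr:
  assumes "distinct (as @ x # bs)"
  shows "\<exists>Q. Q \<noteq> 0 \<and>
    dist_mult Q (corr (as @ x # bs) f) = dist_mult Q (corr (as @ bs @ [x]) f)"
  using assms
proof (induction bs arbitrary: as)
  case Nil
  show ?case by (rule exI[of _ 1]) simp
next
  case (Cons z bs)
  obtain Q where Q: "Q \<noteq> 0"
    "dist_mult Q (corr (as @ x # z # bs) f) = dist_mult Q (corr (as @ z # x # bs) f)"
    using locality_corr[OF Cons.prems] by blast
  obtain Q' where Q': "Q' \<noteq> 0"
    "dist_mult Q' (corr (as @ z # x # bs) f) = dist_mult Q' (corr (as @ z # bs @ [x]) f)"
    using Cons.IH[of "as @ [z]"] Cons.prems by auto
  have "dist_mult (Q' * Q) (corr (as @ x # z # bs) f) = dist_mult (Q' * Q) (corr (as @ z # bs @ [x]) f)"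
    unfolding dist_mult_mult Q(2) by (metis Q'(2) dist_mult_commute)
  then show ?case using Q(1) Q'(1) by (intro exI[of _ "Q' * Q"]) simp
qed

lemma corr_last_nonneg:
  assumes "corr (as @ [x]) f e \<noteq> 0"
  shows "e x \<ge> 0"
proof (rule ccontr)
  assume "\<not> e x \<ge> 0"
  then have "foldr (mode f e) (as @ [x]) (vac V) = foldr (mode f e) as 0"
    by (simp add: creation)
  then have "B (vac V) (foldr (mode f e) (as @ [x]) (vac V)) = 0"
    using module_hom.zero[OF module_hom_B_foldr, of "vac V" f "\<lambda>x. - e x - 1" as] by simp
  then show False using assms by (simp add: corr_eq split: if_splits)
qed

lemma ex_denominator_nonneg:
  assumes "distinct X"
  obtains Q where "Q \<noteq> 0" "\<And>e x. x \<in> set X \<Longrightarrow> dist_mult Q (corr X f) e \<noteq> 0 \<Longrightarrow> e x \<ge> 0"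
proof -
  have "\<exists>Q. Q \<noteq> 0 \<and> (\<forall>e. dist_mult Q (corr X f) e \<noteq> 0 \<longrightarrow> e x \<ge> 0)" if x: "x \<in> set X" for x
  proof -
    obtain as bs where X: "X = as @ x # bs" using split_list[OF x] by blast
    obtain Q where Q: "Q \<noteq> 0" "dist_mult Q (corr X f) = dist_mult Q (corr (as @ bs @ [x]) f)"
      using move_to_end_corr[of as x bs f] assms X by blast
    have "e x \<ge> 0" if "dist_mult Q (corr X f) e \<noteq> 0" for e
      using dist_mult_nonneg[of "corr (as @ bs @ [x]) f" x Q e] corr_last_nonneg[of "as @ bs" x f] that
      unfolding Q(2) by auto
    then show ?thesis using Q(1) by blast
  qed
  then obtain q where q: "\<And>x. x \<in> set X \<Longrightarrow> q x \<noteq> 0"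
    "\<And>x e. x \<in> set X \<Longrightarrow> dist_mult (q x) (corr X f) e \<noteq> 0 \<Longrightarrow> e x \<ge> 0"
    by metis
  show thesis
  proof (rule that)
    show "(\<Prod>x\<in>set X. q x) \<noteq> 0" using q(1) by simp
    fix e x assume x: "x \<in> set X" and e: "dist_mult (\<Prod>x\<in>set X. q x) (corr X f) e \<noteq> 0"
    have "(\<Prod>x\<in>set X. q x) = (\<Prod>x\<in>set X - {x}. q x) * q x"
      using x by (simp add: prod.remove[of "set X" x] mult.commute)
    with e have "dist_mult (\<Prod>x\<in>set X - {x}. q x) (dist_mult (q x) (corr X f)) e \<noteq> 0"
      by (simp add: dist_mult_mult)
    then show "e x \<ge> 0" by (rule dist_mult_nonneg[rotated]) (use q(2) x in blast)
  qed
qed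

lemma foldr_mode_wt_space:
  assumes "\<And>x. x \<in> set X \<Longrightarrow> f x \<in> wt_space V (k x)" "distinct X"
  shows "foldr (mode f e) X (vac V) \<in> wt_space V (\<Sum>x\<in>set X. k x + e x)"
  using assms
proof (induction X)
  case (Cons x X)
  then have "vop V (f x) (- e x - 1) (foldr (mode f e) X (vac V)) \<in>
      wt_space V (k x + (\<Sum>x\<in>set X. k x + e x) - (- e x - 1) - 1)"
    by (intro wt_space_vop) auto
  then show ?case using Cons.prems by (simp add: algebra_simps)
qed (simp add: vac_wt_space)

lemma corr_total_degree:
  assumes "\<And>x. x \<in> set X \<Longrightarrow> f x \<in> wt_space V (k x)" "distinct X" "corr X f e \<noteq> 0"
  shows "(\<Sum>x\<in>set X. e x) = - (\<Sum>x\<in>set X. k x)"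
proof -
  have "(\<Sum>x\<in>set X. k x + e x) = 0"
    using B_wt_space[OF vac_wt_space foldr_mode_wt_space[of X f k e]] assms
    by (auto simp: corr_eq split: if_splits)
  then show ?thesis by (simp add: sum.distrib)
qed

text \<open>
  Bringing the insertion at \<open>x\<close> to the right end shows that a product of factors \<open>x - z\<close> clears
  all negative powers of \<open>x\<close>.  The total degree of the series is fixed by the grading, so the
  product over all insertions turns it into a polynomial.
\<close>

theorem expands_corr:
  assumes "distinct X" and hom: "\<And>x. x \<in> set X \<Longrightarrow> f x \<in> wt_space V (k x)"
  shows "expands (corr X f) (Z0 V B (map (\<lambda>x. (f x, x)) X))"
proof -
  obtain Q where Q: "Q \<noteq> 0"
    "\<And>e x. x \<in> set X \<Longrightarrow> dist_mult Q (corr X f) e \<noteq> 0 \<Longrightarrow> e x \<ge> 0"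
    using ex_denominator_nonneg[OF assms(1), of f] by blast
  let ?S = "dist_mult Q (corr X f)"
  let ?sh = "\<lambda>m e t. e t - int (Poly_Mapping.lookup m t)"
  have term_nz: "\<exists>m\<in>Poly_Mapping.keys Q. corr X f (?sh m e) \<noteq> 0" if "?S e \<noteq> 0" for e
    using that unfolding dist_mult_def by (metis (no_types, lifting) mult_zero_right sum.neutral)
  have supp: "e t = 0" if "corr X f e \<noteq> 0" "t \<notin> set X" for e t
    using that by (auto simp: corr_eq split: if_splits)
  \<comment> \<open>After division by a monomial \<open>m\<close> of \<open>Q\<close>, the exponents in \<open>X\<close> add up to \<open>K\<close> and are at least
    those of \<open>1/m\<close>, which confines each of them to the interval in \<open>F m\<close>.\<close>
  define K where "K = - (\<Sum>x\<in>set X. k x)"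
  define M where "M m = (\<Sum>x\<in>set X. int (Poly_Mapping.lookup m x))" for m
  define F where "F m = {e :: var \<Rightarrow> int. \<forall>x. (x \<in> set X \<longrightarrow> e x \<in> {- M m..K + M m}) \<and>
    (x \<notin> set X \<longrightarrow> e x = 0)}" for m
  have finF: "finite (F m)" for m
    unfolding F_def by (rule finite_set_of_finite_funs) auto
  have inF: "?sh m e \<in> F m" if e: "?S e \<noteq> 0" and m: "corr X f (?sh m e) \<noteq> 0" for m e
  proof -
    let ?e = "?sh m e"
    have low: "?e x \<ge> - int (Poly_Mapping.lookup m x)" if "x \<in> set X" for x
      using Q(2)[OF that e] by simp
    have bound: "- M m \<le> ?e x \<and> ?e x \<le> K + M m" if x: "x \<in> set X" for x
    proof
      have "int (Poly_Mapping.lookup m x) \<le> M m"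
        unfolding M_def using x by (intro member_le_sum) auto
      then show "- M m \<le> ?e x" using low[OF x] by linarith
      have "?e x + (\<Sum>t\<in>set X - {x}. ?e t) = (\<Sum>t\<in>set X. ?e t)"
        using x by (simp add: sum.remove[of "set X" x])
      also have "\<dots> = K"
        using corr_total_degree[OF hom assms(1) m] by (simp add: K_def)
      finally have "?e x + (\<Sum>t\<in>set X - {x}. ?e t) = K" .
      moreover have "(\<Sum>t\<in>set X - {x}. - int (Poly_Mapping.lookup m t)) \<le> (\<Sum>t\<in>set X - {x}. ?e t)"
        by (rule sum_mono) (use low in auto)
      moreover have "(\<Sum>t\<in>set X - {x}. int (Poly_Mapping.lookup m t)) \<le> M m"
        unfolding M_def by (rule sum_mono2) auto
      ultimately show "?e x \<le> K + M m" by (simp add: sum_negf)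
    qed
    then show ?thesis unfolding F_def using supp[OF m] by auto
  qed
  have "{e. ?S e \<noteq> 0} \<subseteq> (\<Union>m\<in>Poly_Mapping.keys Q. (\<lambda>e t. e t + int (Poly_Mapping.lookup m t)) ` F m)"
  proof
    fix e assume "e \<in> {e. ?S e \<noteq> 0}"
    then have e: "?S e \<noteq> 0" by simp
    then obtain m where m: "m \<in> Poly_Mapping.keys Q" "corr X f (?sh m e) \<noteq> 0"
      using term_nz by blast
    have "e = (\<lambda>t. ?sh m e t + int (Poly_Mapping.lookup m t))" by simp
    then show "e \<in> (\<Union>m\<in>Poly_Mapping.keys Q. (\<lambda>e t. e t + int (Poly_Mapping.lookup m t)) ` F m)"
      by (intro UN_I[OF m(1)] image_eqI[OF _ inF[OF e m(2)]])
  qed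
  then have fin: "finite {e. ?S e \<noteq> 0}"
    by (rule finite_subset) (simp add: finF)
  have outside: "\<exists>m. \<forall>t. t \<notin> set X \<longrightarrow> e t = int (Poly_Mapping.lookup m t)" if e: "?S e \<noteq> 0" for e
  proof -
    obtain m where "corr X f (?sh m e) \<noteq> 0" using term_nz[OF e] by blast
    from supp[OF this] show ?thesis by (intro exI[of _ m]) auto
  qed
  have "\<exists>P. ?S = poly_dist P"
  proof (rule finite_support_poly_dist[OF fin])
    fix e x assume e: "?S e \<noteq> 0"
    then show "e x \<ge> 0"
      using Q(2)[OF _ e, of x] outside[OF e] by (cases "x \<in> set X") auto
  next
    fix e assume e: "?S e \<noteq> 0"
    then obtain m where "\<forall>t. t \<notin> set X \<longrightarrow> e t = int (Poly_Mapping.lookup m t)"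
      using outside by blast
    then have "{t. e t \<noteq> 0} \<subseteq> set X \<union> Poly_Mapping.keys m"
      by (auto simp: in_keys_iff)
    then show "finite {t. e t \<noteq> 0}" by (rule finite_subset) simp
  qed
  then obtain P where "?S = poly_dist P" ..
  then have "expands (corr X f) (Fract P Q)" using Q(1) unfolding expands_def by blast
  then show ?thesis using rational_extension_eqI by (metis Z0_def corr_def)
qed

section \<open>Genus zero Ward identities\<close>

text \<open>
  With all other insertions fixed, the correlation function is a linear functional of what the
  mode at \<open>x\<close> does to the state on its right.
\<close>

lemma foldr_slot:
  assumes "distinct X" "x \<in> set X"
  obtains \<Lambda> w where "module_hom (smul V) (*) \<Lambda>"
    "\<And>C. B (vac V) (foldr ((mode f e)(x := C)) X (vac V)) = \<Lambda> (C w)"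
proof -
  obtain as bs where X: "X = as @ x # bs" using split_list[OF assms(2)] by blast
  have "foldr ((mode f e)(x := C)) as = foldr (mode f e) as"
    "foldr ((mode f e)(x := C)) bs = foldr (mode f e) bs" for C
    by (rule ext, rule foldr_cong; use assms X in auto)+
  then have "B (vac V) (foldr ((mode f e)(x := C)) X (vac V)) =
      B (vac V) (foldr (mode f e) as (C (foldr (mode f e) bs (vac V))))" for C
    by (simp add: X)
  with module_hom_B_foldr[of "vac V" f "\<lambda>x. - e x - 1" as] that show thesis by blast
qed

lemma corr_slot:
  assumes "distinct X" "x \<in> set X"
  shows "\<exists>\<Lambda> w. module_hom (smul V) (*) \<Lambda> \<and>
    ((\<forall>t. t \<notin> set X \<longrightarrow> e t = 0) \<longrightarrow>
      (\<forall>C. B (vac V) (foldr ((mode f e)(x := C)) X (vac V)) = \<Lambda> (C w))) \<and>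
    (\<forall>u j. corr X (f(x := u)) (e(x := j)) = \<Lambda> (vop V u (- j - 1) w))"
proof (cases "\<forall>t. t \<notin> set X \<longrightarrow> e t = 0")
  case True
  obtain \<Lambda> w where \<Lambda>: "module_hom (smul V) (*) \<Lambda>"
    "\<And>C. B (vac V) (foldr ((mode f e)(x := C)) X (vac V)) = \<Lambda> (C w)"
    using foldr_slot[OF assms] by metis
  have "corr X (f(x := u)) (e(x := j)) = \<Lambda> (vop V u (- j - 1) w)" for u j
  proof -
    have "mode (f(x := u)) (e(x := j)) = (mode f e)(x := vop V u (- j - 1))"
      by (auto simp: fun_eq_iff)
    moreover have "\<forall>t. t \<notin> set X \<longrightarrow> (e(x := j)) t = 0" using True assms(2) by auto
    ultimately show ?thesis unfolding corr_eq using \<Lambda>(2) by (simp only: if_P)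
  qed
  with \<Lambda> show ?thesis by blast
next
  case False
  then obtain t where "t \<notin> set X" "e t \<noteq> 0" by blast
  then have "corr X g (e(x := j)) = 0" for g j
    using assms(2) by (intro corr_outside[of t]) auto
  then show ?thesis
    using False B_module_hom_right[of 0] by (intro exI[of _ "B 0"] exI[of _ 0]) auto
qed

lemma corr_module_hom:
  assumes "distinct X" "x \<in> set X"
  shows "module_hom (smul V) (*) (\<lambda>u. corr X (f(x := u)) e)"
proof -
  obtain \<Lambda> w where \<Lambda>: "module_hom (smul V) (*) \<Lambda>"
    "\<And>u j. corr X (f(x := u)) (e(x := j)) = \<Lambda> (vop V u (- j - 1) w)"
    using corr_slot[OF assms] by blast
  have "corr X (f(x := u)) e = \<Lambda> (vop V u (- e x - 1) w)" for u
    using \<Lambda>(2)[of u "e x"] by simp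
  then show ?thesis
    using module_hom_compose[OF module_hom_left \<Lambda>(1)] by (simp add: o_def)
qed

lemma corr_L_m1:
  assumes "distinct X" "x \<in> set X"
  shows "corr X (f(x := L V (-1) (f x))) = pd_dist x (corr X f)"
proof
  fix e
  obtain \<Lambda> w where \<Lambda>: "module_hom (smul V) (*) \<Lambda>"
    "\<And>u j. corr X (f(x := u)) (e(x := j)) = \<Lambda> (vop V u (- j - 1) w)"
    using corr_slot[OF assms] by blast
  show "corr X (f(x := L V (-1) (f x))) e = pd_dist x (corr X f) e"
    using \<Lambda>(2)[of "L V (-1) (f x)" "e x"] \<Lambda>(2)[of "f x" "e x + 1"]
    by (simp add: pd_dist_def translation module_hom.scale[OF \<Lambda>(1)])
qed

text \<open>
  Moving \<open>D\<close> to the right through the product leaves one commutator \<open>A' x\<close> per factor, until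
  \<open>D\<close> meets the vector \<open>v0\<close> that it annihilates.  Below, \<open>D\<close> is one of \<open>L(-1)\<close>, \<open>L(0)\<close>, \<open>L(1)\<close>.
\<close>

lemma foldr_derivation:
  assumes "distinct X" "D v0 = 0"
    and "\<And>x. x \<in> set X \<Longrightarrow> module_hom (smul V) (smul V) (A x)"
    and "\<And>x w. x \<in> set X \<Longrightarrow> D (A x w) = A' x w + A x (D w)"
  shows "D (foldr A X v0) = (\<Sum>x\<in>set X. foldr (A(x := A' x)) X v0)"
  using assms
proof (induction X)
  case (Cons x X)
  have x: "x \<notin> set X" using Cons.prems(1) by simp
  have "foldr (A(x := A' x)) X v0 = foldr A X v0"
    by (rule foldr_cong) (use x in auto)
  moreover have "(\<Sum>t\<in>set X. foldr (A(t := A' t)) (x # X) v0) =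
      (\<Sum>t\<in>set X. A x (foldr (A(t := A' t)) X v0))"
    by (rule sum.cong) (use x in auto)
  ultimately have "(\<Sum>t\<in>set (x # X). foldr (A(t := A' t)) (x # X) v0) =
      A' x (foldr A X v0) + (\<Sum>t\<in>set X. A x (foldr (A(t := A' t)) X v0))"
    using x by simp
  also have "\<dots> = A' x (foldr A X v0) + A x (D (foldr A X v0))"
  proof -
    have "D (foldr A X v0) = (\<Sum>t\<in>set X. foldr (A(t := A' t)) X v0)"
      by (rule Cons.IH) (use Cons.prems in simp_all)
    moreover have "module_hom (smul V) (smul V) (A x)" using Cons.prems(3) by simp
    ultimately show ?thesis by (simp only: module_hom.sum)
  qed
  also have "\<dots> = D (foldr A (x # X) v0)"
    using Cons.prems(4)[of x] by simp
  finally show ?case ..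
qed simp

lemma vacuum_expectation_commutators:
  assumes "distinct X" "j \<in> {-1, 0, 1}"
    and "\<And>x w. x \<in> set X \<Longrightarrow> L V j (mode f e x w) = A' x w + mode f e x (L V j w)"
  shows "(\<Sum>x\<in>set X. B (vac V) (foldr ((mode f e)(x := A' x)) X (vac V))) = 0"
proof -
  have "L V j (foldr (mode f e) X (vac V)) =
      (\<Sum>x\<in>set X. foldr ((mode f e)(x := A' x)) X (vac V))"
    by (rule foldr_derivation) (use assms module_hom_right L_vac in auto)
  then have "(\<Sum>x\<in>set X. B (vac V) (foldr ((mode f e)(x := A' x)) X (vac V))) =
      B (vac V) (L V j (foldr (mode f e) X (vac V)))"
    by (simp add: B_sum_right)
  also have "\<dots> = 0" using assms(2) by (auto intro: B_vac_L)
  finally show ?thesis .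
qed

text \<open>
  The global conformal Ward identities for \<open>L(-1)\<close>, \<open>L(0)\<close> and \<open>L(1)\<close>, which correspond to
  \<open>p = 1, x, x\<^sup>2\<close>.  They hold because these three operators annihilate the vacuum on both sides.
\<close>

lemma ward_corr:
  assumes "distinct X" and hom: "\<And>x. x \<in> set X \<Longrightarrow> f x \<in> wt_space V (k x)"
  shows "(\<Sum>x\<in>set X. of_int (e x + 1) * corr X f (e(x := e x + 1))) = 0" (is ?T)
    and "(\<Sum>x\<in>set X. of_int (k x + e x) * corr X f e) = 0" (is ?D)
    and "(\<Sum>x\<in>set X. of_int (2 * k x + e x - 1) * corr X f (e(x := e x - 1))
           + corr X (f(x := L V 1 (f x))) e) = 0" (is ?C)
proof -
  have "?T \<and> ?D \<and> ?C"
  proof (cases "\<forall>t. t \<notin> set X \<longrightarrow> e t = 0")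
    case False
    then obtain t where t: "t \<notin> set X" "e t \<noteq> 0" by blast
    have upd: "corr X g (e(x := j)) = 0" if "x \<in> set X" for g x j
      by (rule corr_outside[of t]) (use t that in auto)
    have "corr X g e = 0" for g
      by (rule corr_outside[of t]) (use t in auto)
    with upd show ?thesis by (intro conjI sum.neutral ballI) simp_all
  next
    case True
    let ?m = "mode f e"
    define A0 where "A0 x w = smul V (of_int (e x + 1)) (vop V (f x) (- (e x + 1) - 1) w)" for x w
    define A1 where "A1 x w = smul V (of_int (k x + e x)) (vop V (f x) (- e x - 1) w)" for x w
    define A2 where "A2 x w = smul V (of_int (2 * k x + e x - 1)) (vop V (f x) (- (e x - 1) - 1) w)
        + vop V (L V 1 (f x)) (- e x - 1) w" for x w
    have "B (vac V) (foldr (?m(x := A0 x)) X (vac V)) =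
           of_int (e x + 1) * corr X f (e(x := e x + 1))"
      and "B (vac V) (foldr (?m(x := A1 x)) X (vac V)) = of_int (k x + e x) * corr X f e"
      and "B (vac V) (foldr (?m(x := A2 x)) X (vac V)) =
           of_int (2 * k x + e x - 1) * corr X f (e(x := e x - 1)) + corr X (f(x := L V 1 (f x))) e"
      if x: "x \<in> set X" for x
    proof -
      obtain \<Lambda> w where \<Lambda>: "module_hom (smul V) (*) \<Lambda>"
        "\<And>C. (\<forall>t. t \<notin> set X \<longrightarrow> e t = 0) \<Longrightarrow> B (vac V) (foldr (?m(x := C)) X (vac V)) = \<Lambda> (C w)"
        "\<And>u j. corr X (f(x := u)) (e(x := j)) = \<Lambda> (vop V u (- j - 1) w)"
        using corr_slot[OF assms(1) x, of e f] by blast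
      note lin = module_hom.scale[OF \<Lambda>(1)] module_hom.add[OF \<Lambda>(1)]
      show "B (vac V) (foldr (?m(x := A0 x)) X (vac V)) =
           of_int (e x + 1) * corr X f (e(x := e x + 1))"
        by (simp only: \<Lambda>(2)[OF True] A0_def lin \<Lambda>(3)[of "f x", unfolded fun_upd_triv])
      show "B (vac V) (foldr (?m(x := A1 x)) X (vac V)) = of_int (k x + e x) * corr X f e"
        by (simp only: \<Lambda>(2)[OF True] A1_def lin \<Lambda>(3)[of "f x" "e x", unfolded fun_upd_triv])
      show "B (vac V) (foldr (?m(x := A2 x)) X (vac V)) =
           of_int (2 * k x + e x - 1) * corr X f (e(x := e x - 1)) + corr X (f(x := L V 1 (f x))) e"
        by (simp only: \<Lambda>(2)[OF True] A2_def lin \<Lambda>(3)[of "f x", unfolded fun_upd_triv]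
            \<Lambda>(3)[of _ "e x", unfolded fun_upd_triv])
    qed
    moreover have "(\<Sum>x\<in>set X. B (vac V) (foldr (?m(x := A0 x)) X (vac V))) = 0"
    proof (rule vacuum_expectation_commutators[OF assms(1), of "-1"])
      show "L V (-1) (?m x w) = A0 x w + ?m x (L V (-1) w)" for x w
        unfolding L_m1_commutator A0_def by (simp add: add.commute)
    qed simp
    moreover have "(\<Sum>x\<in>set X. B (vac V) (foldr (?m(x := A1 x)) X (vac V))) = 0"
    proof (rule vacuum_expectation_commutators[OF assms(1), of 0])
      show "L V 0 (?m x w) = A1 x w + ?m x (L V 0 w)" if "x \<in> set X" for x w
        unfolding L_0_commutator[OF hom[OF that]] A1_def by simp
    qed simp
    moreover have "(\<Sum>x\<in>set X. B (vac V) (foldr (?m(x := A2 x)) X (vac V))) = 0"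
    proof (rule vacuum_expectation_commutators[OF assms(1), of 1])
      show "L V 1 (?m x w) = A2 x w + ?m x (L V 1 w)" if "x \<in> set X" for x w
      proof -
        have "2 * k x - (- e x - 1) - 2 = 2 * k x + e x - 1" "- e x - 1 + 1 = - (e x - 1) - 1" by simp_all
        then show ?thesis unfolding L_1_commutator[OF hom[OF that]] A2_def by (simp only:)
      qed
    qed simp
    ultimately show ?thesis by simp
  qed
  then show ?T ?D ?C by blast+
qed

end

section \<open>Sums over dual bases\<close>

context voa_form
begin

context
  fixes S :: "'v set" and d :: "'v \<Rightarrow> 'v"
  assumes basis: "homogeneous_basis V S" and dual: "dual_basis B S d"
begin

lemma eq_if_B_basis_eq:
  assumes "\<And>b. b \<in> S \<Longrightarrow> B b u = B b u'"
  shows "u = u'"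
proof -
  have "B x (u - u') = 0" for x
  proof -
    have "x \<in> span S" using basis by (simp add: homogeneous_basis_def)
    then show ?thesis
      by (induction rule: span_induct_alt)
         (simp_all add: B_add_left B_scale_left B_diff_right assms)
  qed
  then have "u - u' = 0" using nondegenerate unfolding nondegenerate_def by blast
  then show ?thesis by simp
qed

text \<open>
  Homogeneity passes to the dual basis because \<open>L(0)\<close> is self-adjoint and diagonal in the basis.
\<close>

lemma dual_basis_wt_space:
  assumes "b \<in> S" "b \<in> wt_space V h"
  shows "d b \<in> wt_space V h"
proof -
  have "L V 0 (d b) = smul V (of_int h) (d b)"
  proof (rule eq_if_B_basis_eq)
    fix b' assume b': "b' \<in> S"
    then obtain h' where h': "L V 0 b' = smul V (of_int h') b'"
      using basis by (auto simp: homogeneous_basis_def wt_space_def)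
    have "B b' (L V 0 (d b)) = B (L V 0 b') (d b)" by (simp add: L_adjoint)
    also have "\<dots> = of_int h * B b' (d b)"
    proof (cases "b' = b")
      case True
      then show ?thesis using assms(2) by (simp add: wt_space_def B_scale_left)
    next
      case False
      then have "B b' (d b) = 0" using dual assms(1) b' by (simp add: dual_basis_def)
      then show ?thesis by (simp add: h' B_scale_left)
    qed
    finally show "B b' (L V 0 (d b)) = B b' (smul V (of_int h) (d b))"
      by (simp add: B_scale_right)
  qed
  then show ?thesis by (simp add: wt_space_def)
qed

lemma finite_basis_wt_space: "finite {b \<in> S. b \<in> wt_space V h}"
proof -
  obtain A where "finite A" "wt_space V h = span A" using grading_finite by blast
  moreover have "independent {b \<in> S. b \<in> wt_space V h}"
    using basis independent_mono[of S "{b \<in> S. b \<in> wt_space V h}"]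
    by (simp add: homogeneous_basis_def subset_iff)
  ultimately show ?thesis using independent_span_bound by blast
qed

lemma basis_expansion:
  assumes "u \<in> wt_space V h"
  shows "u = (\<Sum>b | b \<in> S \<and> b \<in> wt_space V h. smul V (B u (d b)) b)"
proof -
  have "u \<in> span S" using basis by (simp add: homogeneous_basis_def)
  then obtain T r where T: "finite T" "T \<subseteq> S" and u: "u = (\<Sum>b\<in>T. smul V (r b) b)"
    unfolding span_explicit by blast
  have coeff: "B u (d b) = (if b \<in> T then r b else 0)" if "b \<in> S" for b
  proof -
    have "B u (d b) = (\<Sum>b'\<in>T. r b' * B b' (d b))"
      unfolding u by (simp add: B_sum_left B_scale_left)
    also have "\<dots> = (\<Sum>b'\<in>T. if b' = b then r b' else 0)"
      using T that dual by (intro sum.cong) (auto simp: dual_basis_def)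
    finally show ?thesis using T by simp
  qed
  have zero: "B u (d b) = 0" if "b \<in> S" "b \<notin> wt_space V h" for b
  proof -
    obtain h' where "b \<in> wt_space V h'" using basis \<open>b \<in> S\<close> by (auto simp: homogeneous_basis_def)
    then show ?thesis
      using B_wt_space[OF assms dual_basis_wt_space[OF \<open>b \<in> S\<close>, of h']] that(2) by blast
  qed
  have "(\<Sum>b\<in>T. smul V (r b) b) = (\<Sum>b | b \<in> S \<and> b \<in> wt_space V h. smul V (B u (d b)) b)"
  proof (rule sum.mono_neutral_cong)
    fix b assume "b \<in> T - {b \<in> S. b \<in> wt_space V h}"
    then show "smul V (r b) b = 0" using T coeff[of b] zero[of b] by auto
  qed (use T finite_basis_wt_space[of h] coeff in auto)
  then show ?thesis using u by simp
qed

lemma dual_basis_expansion: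
  assumes "u \<in> wt_space V h"
  shows "u = (\<Sum>b | b \<in> S \<and> b \<in> wt_space V h. smul V (B b u) (d b))"
proof (rule eq_if_B_basis_eq)
  fix b' assume b': "b' \<in> S"
  then obtain h' where h': "b' \<in> wt_space V h'" using basis by (auto simp: homogeneous_basis_def)
  have "B b' (\<Sum>b | b \<in> S \<and> b \<in> wt_space V h. smul V (B b u) (d b)) =
      (\<Sum>b | b \<in> S \<and> b \<in> wt_space V h. if b' = b then B b u else 0)"
    using b' dual by (auto simp: B_sum_right B_scale_right dual_basis_def intro!: sum.cong)
  also have "\<dots> = (if b' \<in> wt_space V h then B b' u else 0)"
    using b' finite_basis_wt_space[of h] by simp
  also have "\<dots> = B b' u"
    using B_wt_space[OF h' assms] h' by auto
  finally show "B b' u = B b' (\<Sum>b | b \<in> S \<and> b \<in> wt_space V h. smul V (B b u) (d b))" ..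
qed

text \<open>
  The Casimir element \<open>\<Sum> b \<otimes> d b\<close> of one weight intertwines \<open>L(1)\<close> on either factor
  with \<open>L(-1)\<close> on the other one, because these operators are adjoint.  This is what turns the
  terms with \<open>L(1)\<close> at the points \<open>w\<^sub>a\<close> into derivatives with respect to \<open>w\<^sub>-\<^sub>a\<close>, at the cost of
  lowering the weight, that is, of a factor \<open>\<rho>\<^sub>a\<close>.
\<close>

lemma casimir_L_1:
  assumes left: "\<And>u'. module_hom (smul V) (*) (\<lambda>u. \<Phi> u u')"
    and right: "\<And>u. module_hom (smul V) (*) (\<Phi> u :: 'v \<Rightarrow> complex)"
  shows "(\<Sum>b | b \<in> S \<and> b \<in> wt_space V h. \<Phi> (L V 1 b) (d b)) =
      (\<Sum>b | b \<in> S \<and> b \<in> wt_space V (h - 1). \<Phi> b (L V (-1) (d b)))" (is ?left)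
    and "(\<Sum>b | b \<in> S \<and> b \<in> wt_space V h. \<Phi> b (L V 1 (d b))) =
      (\<Sum>b | b \<in> S \<and> b \<in> wt_space V (h - 1). \<Phi> (L V (-1) b) (d b))" (is ?right)
proof -
  let ?S = "\<lambda>h. {b. b \<in> S \<and> b \<in> wt_space V h}"
  note lin = module_hom.sum[OF left] module_hom.sum[OF right]
    module_hom.scale[OF left] module_hom.scale[OF right]
  have down: "L V 1 b \<in> wt_space V (h - 1)" if "b \<in> wt_space V h" for b
    using wt_space_L[OF that, of 1] .
  have up: "L V (-1) b \<in> wt_space V h" if "b \<in> wt_space V (h - 1)" for b
    using wt_space_L[OF that, of "-1"] by simp
  \<comment> \<open>After expansion of the changed factor in the basis or the dual basis, both sides are the same
    double sum over \<open>?S h\<close> and \<open>?S (h - 1)\<close>.\<close>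
  have "\<Phi> (L V 1 b) (d b) = (\<Sum>b'\<in>?S (h - 1). B (L V 1 b) (d b') * \<Phi> b' (d b))"
    if "b \<in> ?S h" for b
    using that by (subst basis_expansion[OF down]) (auto simp: lin)
  moreover have "\<Phi> b' (L V (-1) (d b')) = (\<Sum>b\<in>?S h. B b (L V (-1) (d b')) * \<Phi> b' (d b))"
    if "b' \<in> ?S (h - 1)" for b'
    using that dual_basis_wt_space
    by (subst dual_basis_expansion[OF up]) (auto simp: lin)
  ultimately show ?left
    by (simp add: L_adjoint[of 1] sum.swap[of _ "?S h"])
  have "\<Phi> b (L V 1 (d b)) = (\<Sum>b'\<in>?S (h - 1). B b' (L V 1 (d b)) * \<Phi> b (d b'))"
    if "b \<in> ?S h" for b
    using that dual_basis_wt_space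
    by (subst dual_basis_expansion[OF down]) (auto simp: lin)
  moreover have "\<Phi> (L V (-1) b') (d b') = (\<Sum>b\<in>?S h. B (L V (-1) b') (d b) * \<Phi> b (d b'))"
    if "b' \<in> ?S (h - 1)" for b'
    using that by (subst basis_expansion[OF up]) (auto simp: lin)
  ultimately show ?right
    by (simp add: L_adjoint[of "-1"] sum.swap[of _ "?S h"])
qed

end

end

section \<open>Correlation functions of genus g\<close>

lemma sum_PiE_split:
  assumes "i \<in> I"
  shows "(\<Sum>b\<in>Pi\<^sub>E I C. G b) = (\<Sum>b\<in>Pi\<^sub>E (I - {i}) C. \<Sum>\<beta>\<in>C i. G (b(i := \<beta>)))"
proof -
  have I: "I = insert i (I - {i})" using assms by auto
  have "(\<Sum>b\<in>Pi\<^sub>E I C. G b) = (\<Sum>b\<in>(\<lambda>(\<beta>, b). b(i := \<beta>)) ` (C i \<times> Pi\<^sub>E (I - {i}) C). G b)"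
    by (subst I, subst PiE_insert_eq) simp
  also have "\<dots> = (\<Sum>(\<beta>, b)\<in>C i \<times> Pi\<^sub>E (I - {i}) C. G (b(i := \<beta>)))"
    by (subst sum.reindex[OF inj_combinator]) (auto simp: case_prod_beta)
  also have "\<dots> = (\<Sum>\<beta>\<in>C i. \<Sum>b\<in>Pi\<^sub>E (I - {i}) C. G (b(i := \<beta>)))"
    by (rule sum.cartesian_product[symmetric])
  also have "\<dots> = (\<Sum>b\<in>Pi\<^sub>E (I - {i}) C. \<Sum>\<beta>\<in>C i. G (b(i := \<beta>)))"
    by (rule sum.swap)
  finally show ?thesis .
qed

definition insertion_points :: "nat \<Rightarrow> nat \<Rightarrow> var list" where
  "insertion_points g n = map var.y [1..<Suc n] @
     concat (map (\<lambda>a. [var.w (int a), var.w (- int a)]) [1..<Suc g])"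

lemma set_insertion_points:
  "set (insertion_points g n) = var.y ` {1..n} \<union> var.w ` index_set g"
proof -
  have "a \<in> (\<Union>i\<in>{1..<Suc g}. {int i, - int i})" if "a \<in> index_set g" for a
    using that by (intro UN_I[of "nat \<bar>a\<bar>"]) (auto simp: index_set_def)
  then have "index_set g = (\<Union>a\<in>{1..<Suc g}. {int a, - int a})"
    by (auto simp: index_set_def)
  then show ?thesis by (auto simp: insertion_points_def)
qed

lemma distinct_insertion_points: "distinct (insertion_points g n)"
proof -
  have "distinct (concat (map (\<lambda>a. [var.w (int a), var.w (- int a)]) [1..<Suc g]))"
    by (induction g) (auto simp: distinct_append)
  moreover have "distinct (map var.y [1..<Suc n])"
    by (simp add: distinct_map inj_on_def)
  ultimately show ?thesis by (auto simp: insertion_points_def)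
qed

lemma sum_insertion_points:
  "(\<Sum>x\<in>set (insertion_points g n). G x) =
     (\<Sum>a\<in>index_set g. G (var.w a)) + (\<Sum>k\<in>{1..n}. G (var.y k))"
proof -
  have "finite (index_set g)"
    by (rule finite_subset[of _ "{- int g..int g}"]) (auto simp: index_set_def)
  then show ?thesis
    unfolding set_insertion_points
    by (subst sum.union_disjoint) (auto simp: sum.reindex inj_on_def add.commute)
qed

text \<open>
  \<open>m a\<close> is the power of \<open>\<rho>\<^sub>a\<close>, hence the weight of the states at \<open>w\<^sub>a\<close> and \<open>w\<^sub>-\<^sub>a\<close>.
\<close>

definition insertion_weight :: "(nat \<Rightarrow> int) \<Rightarrow> (nat \<Rightarrow> nat) \<Rightarrow> var \<Rightarrow> int" where
  "insertion_weight h m x = (case x of var.y k \<Rightarrow> h k | var.w a \<Rightarrow> int (m (nat \<bar>a\<bar>)))"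

locale genus_g_bases = voa_form V B for V :: "'v::ab_group_add voa_data" and B +
  fixes S :: "nat \<Rightarrow> 'v set" and d :: "nat \<Rightarrow> 'v \<Rightarrow> 'v" and g n :: nat
  assumes basis: "a \<in> {1..g} \<Longrightarrow> homogeneous_basis V (S a)"
    and dual: "a \<in> {1..g} \<Longrightarrow> dual_basis B (S a) (d a)"
begin

abbreviation X :: "var list" where "X \<equiv> insertion_points g n"

definition state :: "(nat \<Rightarrow> 'v) \<Rightarrow> (nat \<Rightarrow> 'v) \<Rightarrow> var \<Rightarrow> 'v" where
  "state v b x = (case x of var.y k \<Rightarrow> v k
     | var.w a \<Rightarrow> if a > 0 then b (nat a) else d (nat (- a)) (b (nat (- a))))"

definition weight_basis :: "(nat \<Rightarrow> nat) \<Rightarrow> nat \<Rightarrow> 'v set" where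
  "weight_basis m a = {b \<in> S a. b \<in> wt_space V (int (m a))}"

text \<open>
  The series expanding the coefficient of \<open>\<rho>\<^sup>m\<close> in \<^const>\<open>Z_V\<close>.  Each summand is multilinear in the
  inserted states, so basis expansions can be inserted into it without regard to rationality.
\<close>

definition Z_series :: "(nat \<Rightarrow> 'v) \<Rightarrow> (nat \<Rightarrow> nat) \<Rightarrow> dist" where
  "Z_series v m = (\<lambda>e. if \<exists>a. a \<notin> {1..g} \<and> m a \<noteq> 0 then 0
     else \<Sum>b\<in>Pi\<^sub>E {1..g} (weight_basis m). corr X (state v b) e)"

lemma map_insertion_points:
  "map (\<lambda>x. (state v b x, x)) X = map (\<lambda>k. (v k, var.y k)) [1..<Suc n] @
     concat (map (\<lambda>a. [(b a, var.w (int a)), (d a (b a), var.w (- int a))]) [1..<Suc g])"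
proof -
  have "map (\<lambda>a. map (\<lambda>x. (state v b x, x)) [var.w (int a), var.w (- int a)]) [1..<Suc g] =
      map (\<lambda>a. [(b a, var.w (int a)), (d a (b a), var.w (- int a))]) [1..<Suc g]"
    by (rule map_cong) (auto simp: state_def)
  then show ?thesis
    by (simp only: insertion_points_def map_append map_concat map_map o_def) (simp add: state_def)
qed

lemma state_wt_space:
  assumes "\<And>k. k \<in> {1..n} \<Longrightarrow> v k \<in> wt_space V (h k)"
    and "b \<in> Pi\<^sub>E {1..g} (weight_basis m)" "x \<in> set X"
  shows "state v b x \<in> wt_space V (insertion_weight h m x)"
proof (cases x)
  case (y k)
  then show ?thesis using assms
    by (auto simp: set_insertion_points state_def insertion_weight_def)
next
  case (w a)
  define i where "i = nat \<bar>a\<bar>"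
  have "a \<in> index_set g" using assms(3) w by (auto simp: set_insertion_points)
  then have i: "i \<in> {1..g}" and sgn: "a > 0 \<and> i = nat a \<or> \<not> a > 0 \<and> i = nat (- a)"
    by (auto simp: i_def index_set_def)
  have "b i \<in> weight_basis m i" using assms(2) i by auto
  then have "b i \<in> wt_space V (int (m i))" "d i (b i) \<in> wt_space V (int (m i))"
    using dual_basis_wt_space[OF basis[OF i] dual[OF i]] by (auto simp: weight_basis_def)
  then show ?thesis using sgn w
    by (auto simp: state_def insertion_weight_def i_def)
qed

lemma expands_Z_V:
  assumes "\<And>k. k \<in> {1..n} \<Longrightarrow> v k \<in> wt_space V (h k)"
  shows "expands (Z_series v m) (Z_V V B S d g n v m)"
proof (cases "\<exists>a. a \<notin> {1..g} \<and> m a \<noteq> 0")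
  case True
  then show ?thesis by (simp only: Z_series_def Z_V_def if_True expands_zero)
next
  case False
  have "expands (corr X (state v b)) (Z0 V B (map (\<lambda>x. (state v b x, x)) X))"
    if "b \<in> Pi\<^sub>E {1..g} (weight_basis m)" for b
    by (rule expands_corr[OF distinct_insertion_points
          state_wt_space[where v = v and h = h, OF assms that]])
  then show ?thesis
    using False unfolding Z_series_def Z_V_def map_insertion_points weight_basis_def
    by (simp only: if_False) (rule expands_sum, simp)
qed

lemma state_upd_basis:
  assumes "i \<in> {1..g}"
  shows "state v (b(i := \<beta>)) = (state v b)(var.w (int i) := \<beta>, var.w (- int i) := d i \<beta>)"
proof
  fix x
  show "state v (b(i := \<beta>)) x = ((state v b)(var.w (int i) := \<beta>, var.w (- int i) := d i \<beta>)) x"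
    using assms by (cases x) (auto simp: state_def nat_eq_iff2)
qed

lemma state_upd_y: "(state v b)(var.y k := u) = state (v(k := u)) b"
  by (rule ext) (auto simp: state_def split: var.split)

text \<open>
  With the states at all points other than \<open>w\<^sub>a\<close> and \<open>w\<^sub>-\<^sub>a\<close> fixed, the correlation function is
  bilinear in the two states there, and \<open>casimir_L_1\<close> applies to the sum over their common basis.
  Its two parts are the cases \<open>a > 0\<close> and \<open>a < 0\<close>.
\<close>

lemma sum_L_1_at_w:
  assumes a: "a \<in> index_set g" and m: "\<forall>a. a \<notin> {1..g} \<longrightarrow> m a = 0"
  shows "(\<Sum>b\<in>Pi\<^sub>E {1..g} (weight_basis m).
      corr X ((state v b)(var.w a := L V 1 (state v b (var.w a)))) e) =
    (if m (nat \<bar>a\<bar>) = 0 then 0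
     else pd_dist (var.w (- a)) (Z_series v (m(nat \<bar>a\<bar> := m (nat \<bar>a\<bar>) - 1))) e)"
proof -
  define i where "i = nat \<bar>a\<bar>"
  have i: "i \<in> {1..g}" using a by (auto simp: i_def index_set_def)
  have ai: "a = int i \<or> a = - int i" using a by (auto simp: i_def)
  define m' where "m' = m(i := m i - 1)"
  have wX: "var.w (int i) \<in> set X" "var.w (- int i) \<in> set X" "var.w (- a) \<in> set X"
    using i a by (auto simp: set_insertion_points index_set_def)
  have ne: "var.w (int i) \<noteq> var.w (- int i)" using i by auto
  define \<Phi> where "\<Phi> b u u' = corr X ((state v b)(var.w (int i) := u, var.w (- int i) := u')) e"
    for b u u'
  have right: "module_hom (smul V) (*) (\<Phi> b u)" for b u
    unfolding \<Phi>_def by (rule corr_module_hom[OF distinct_insertion_points wX(2)])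
  have left: "module_hom (smul V) (*) (\<lambda>u. \<Phi> b u u')" for b u'
    unfolding \<Phi>_def fun_upd_twist[OF ne]
    by (rule corr_module_hom[OF distinct_insertion_points wX(1)])
  have state_pos: "state v (b(i := \<beta>)) (var.w (int i)) = \<beta>"
    and state_neg: "state v (b(i := \<beta>)) (var.w (- int i)) = d i \<beta>" for b \<beta>
    using i by (auto simp: state_def)
  have upd: "(state v (b(i := \<beta>)))(var.w a := u) =
      (if a = int i then (state v b)(var.w (int i) := u, var.w (- int i) := d i \<beta>)
       else (state v b)(var.w (int i) := \<beta>, var.w (- int i) := u))"
    if "a = int i \<or> a = - int i" for a b \<beta> u
    using that ne i unfolding state_upd_basis[OF i] by (auto simp: fun_eq_iff)
  define C where "C h = {\<beta>. \<beta> \<in> S i \<and> \<beta> \<in> wt_space V h}" for h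
  let ?P = "Pi\<^sub>E ({1..g} - {i})"
  have split: "(\<Sum>b\<in>Pi\<^sub>E {1..g} (weight_basis m). G b) =
      (\<Sum>b\<in>?P (weight_basis m). \<Sum>\<beta>\<in>C (int (m i)). G (b(i := \<beta>)))"
    for m and G :: "(nat \<Rightarrow> 'v) \<Rightarrow> complex"
    unfolding sum_PiE_split[OF i] by (simp add: weight_basis_def C_def)
  have P: "?P (weight_basis m') = ?P (weight_basis m)"
    by (rule PiE_cong) (auto simp: weight_basis_def m'_def)
  have neg_a: "- a = int i \<or> - a = - int i" and opp: "- a = int i \<longleftrightarrow> a \<noteq> int i"
    using ai i by auto
  have lower: "(\<Sum>\<beta>\<in>C (int (m i)).
        corr X ((state v (b(i := \<beta>)))(var.w a := L V 1 (state v (b(i := \<beta>)) (var.w a)))) e) =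
      (\<Sum>\<beta>\<in>C (int (m i) - 1).
        corr X ((state v (b(i := \<beta>)))(var.w (- a) := L V (-1) (state v (b(i := \<beta>)) (var.w (- a))))) e)"
    for b
  proof (cases "a = int i")
    case True
    then show ?thesis
      unfolding upd[OF ai] upd[OF neg_a] using opp
        casimir_L_1(1)[OF basis[OF i] dual[OF i] left right, of b "int (m i)"]
      by (simp add: state_pos state_neg C_def \<Phi>_def)
  next
    case False
    then have a: "a = - int i" using ai by simp
    show ?thesis
      unfolding upd[OF ai] upd[OF neg_a] using opp False
        casimir_L_1(2)[OF basis[OF i] dual[OF i] left right, of b "int (m i)"]
      by (simp add: a state_pos state_neg C_def \<Phi>_def)
  qed
  have sum: "(\<Sum>b\<in>Pi\<^sub>E {1..g} (weight_basis m).
        corr X ((state v b)(var.w a := L V 1 (state v b (var.w a)))) e) =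
      (\<Sum>b\<in>?P (weight_basis m). \<Sum>\<beta>\<in>C (int (m i) - 1).
        corr X ((state v (b(i := \<beta>)))(var.w (- a) := L V (-1) (state v (b(i := \<beta>)) (var.w (- a))))) e)"
    unfolding split lower ..
  show ?thesis
  proof (cases "m i = 0")
    case True
    \<comment> \<open>There are no states of weight \<open>-1\<close>.\<close>
    have "\<not> dependent (S i)" using basis[OF i] by (simp add: homogeneous_basis_def)
    then have "C (int (m i) - 1) = {}"
      using True wt_space_negative[of _ "-1"] dependent_zero by (auto simp: C_def)
    then show ?thesis using True sum by (simp add: i_def)
  next
    case False
    have m': "\<not> (\<exists>a. a \<notin> {1..g} \<and> m' a \<noteq> 0)" using m i by (auto simp: m'_def)
    have "(\<Sum>b\<in>?P (weight_basis m). \<Sum>\<beta>\<in>C (int (m i) - 1).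
        corr X ((state v (b(i := \<beta>)))(var.w (- a) := L V (-1) (state v (b(i := \<beta>)) (var.w (- a))))) e) =
      (\<Sum>b\<in>Pi\<^sub>E {1..g} (weight_basis m').
        corr X ((state v b)(var.w (- a) := L V (-1) (state v b (var.w (- a))))) e)"
      unfolding split P using False by (simp add: m'_def of_nat_diff)
    also have "\<dots> = pd_dist (var.w (- a)) (Z_series v m') e"
      unfolding corr_L_m1[OF distinct_insertion_points wX(3)] pd_dist_def Z_series_def
      using m' by (simp only: if_False sum_distrib_left)
    finally show ?thesis using False sum by (simp add: m'_def i_def)
  qed
qed

text \<open>The series with \<open>L(1)\<close> inserted at \<open>x\<close>, already rewritten as a derivative when \<open>x\<close> is some \<open>w\<^sub>a\<close>.\<close>

definition L_1_term :: "(nat \<Rightarrow> 'v) \<Rightarrow> (nat \<Rightarrow> nat) \<Rightarrow> var \<Rightarrow> dist" where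
  "L_1_term v m x = (case x of var.y k \<Rightarrow> Z_series (v(k := L V 1 (v k))) m
     | var.w a \<Rightarrow> if m (nat \<bar>a\<bar>) = 0 then (\<lambda>e. 0)
         else pd_dist (var.w (- a)) (Z_series v (m(nat \<bar>a\<bar> := m (nat \<bar>a\<bar>) - 1))))"

lemma ward_Z_series:
  assumes hom: "\<And>k. k \<in> {1..n} \<Longrightarrow> v k \<in> wt_space V (h k)"
  shows "(\<Sum>x\<in>set X. of_int (e x + 1) * Z_series v m (e(x := e x + 1))) = 0" (is ?T)
    and "(\<Sum>x\<in>set X. of_int (insertion_weight h m x + e x) * Z_series v m e) = 0" (is ?D)
    and "(\<Sum>x\<in>set X. of_int (2 * insertion_weight h m x + e x - 1) * Z_series v m (e(x := e x - 1))
           + L_1_term v m x e) = 0" (is ?C)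
proof -
  have "?T \<and> ?D \<and> ?C"
  proof (cases "\<exists>a. a \<notin> {1..g} \<and> m a \<noteq> 0")
    case True
    then have Z: "Z_series v m = (\<lambda>e. 0)" for v by (simp only: Z_series_def if_True)
    have "L_1_term v m x e = 0" if "x \<in> set X" for x
    proof (cases x)
      case (w a)
      then have "nat \<bar>a\<bar> \<in> {1..g}" using that by (auto simp: set_insertion_points index_set_def)
      moreover obtain c where "c \<notin> {1..g}" "m c \<noteq> 0" using True by blast
      ultimately have "c \<notin> {1..g} \<and> (m(nat \<bar>a\<bar> := m (nat \<bar>a\<bar>) - 1)) c \<noteq> 0" by auto
      then have "\<exists>c. c \<notin> {1..g} \<and> (m(nat \<bar>a\<bar> := m (nat \<bar>a\<bar>) - 1)) c \<noteq> 0" ..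
      then have "Z_series v (m(nat \<bar>a\<bar> := m (nat \<bar>a\<bar>) - 1)) = (\<lambda>e. 0)"
        by (simp only: Z_series_def if_True)
      then show ?thesis using w by (simp add: L_1_term_def pd_dist_def)
    qed (simp add: L_1_term_def Z)
    then show ?thesis by (simp add: Z)
  next
    case False
    let ?P = "Pi\<^sub>E {1..g} (weight_basis m)"
    have Z: "Z_series v m e = (\<Sum>b\<in>?P. corr X (state v b) e)" for v e
      using False by (simp only: Z_series_def if_False)
    have L1: "L_1_term v m x e = (\<Sum>b\<in>?P. corr X ((state v b)(x := L V 1 (state v b x))) e)"
      if "x \<in> set X" for x
    proof (cases x)
      case (y k)
      then show ?thesis by (simp add: L_1_term_def Z state_upd_y) (simp add: state_def)
    next
      case (w a)
      then have "a \<in> index_set g" using that by (auto simp: set_insertion_points)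
      moreover have "\<forall>a. a \<notin> {1..g} \<longrightarrow> m a = 0" using False by blast
      ultimately show ?thesis by (simp only: sum_L_1_at_w w) (simp add: L_1_term_def)
    qed
    note ward = ward_corr[where e = e, OF distinct_insertion_points
        state_wt_space[where v = v and h = h and m = m, OF hom]]
    have ?T
      unfolding Z sum_distrib_left by (subst sum.swap) (use ward(1) in simp)
    moreover have ?D
      unfolding Z sum_distrib_left by (subst sum.swap) (use ward(2) in simp)
    moreover have ?C
    proof -
      have "(\<Sum>x\<in>set X. of_int (2 * insertion_weight h m x + e x - 1) * Z_series v m (e(x := e x - 1))
           + L_1_term v m x e) =
        (\<Sum>x\<in>set X. \<Sum>b\<in>?P. of_int (2 * insertion_weight h m x + e x - 1) *
           corr X (state v b) (e(x := e x - 1)) + corr X ((state v b)(x := L V 1 (state v b x))) e)"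
        by (rule sum.cong) (simp_all add: L1 Z sum_distrib_left sum.distrib)
      also have "\<dots> = 0"
        by (subst sum.swap) (use ward(3) in simp)
      finally show ?thesis .
    qed
    ultimately show ?thesis by blast
  qed
  then show ?T ?D ?C by blast+
qed

end

section \<open>The differential equation\<close>

lemma rat_const_zero [simp]: "rat_const 0 = 0"
  by (simp add: rat_const_def Zero_fract_def)

lemma hderiv_at_quadratic:
  "hderiv_at [:c0, c1, c2:] 0 x = rat_const c0 + rat_var x * (rat_const c1 + rat_var x * rat_const c2)"
  "hderiv_at [:c0, c1, c2:] 1 x = rat_const c1 + rat_var x * rat_const (2 * c2)"
  "hderiv_at [:c0, c1, c2:] 2 x = rat_const c2"
  by (simp_all add: hderiv_at_def map_poly_pCons numeral_2_eq_2 pderiv_pCons)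

lemma quadratic_poly_cases:
  fixes p :: "'a::zero poly"
  assumes "degree p \<le> 2"
  obtains c0 c1 c2 where "p = [:c0, c1, c2:]"
proof -
  have "p = [:coeff p 0, coeff p 1, coeff p 2:]"
  proof (rule poly_eqI)
    fix i
    have "coeff p i = 0" if "i > 2" using assms that by (simp add: coeff_eq_0)
    then show "coeff p i = coeff [:coeff p 0, coeff p 1, coeff p 2:] i"
      by (auto simp: coeff_pCons numeral_2_eq_2 split: nat.split)
  qed
  then show thesis by (rule that)
qed

text \<open>
  Multiplication by \<open>x\<close> shifts exponents and the derivative with respect to \<open>x\<close> multiplies by
  them, so that \<open>p \<partial> + k p' + \<onehalf> p'' L(1)\<close> is a combination of the three Ward identities.
\<close>

lemma expands_quadratic_vector_field:
  assumes "expands T Z" "expands R F"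
  shows "expands
    (\<lambda>e. c0 * (of_int (e x + 1) * T (e(x := e x + 1))) + c1 * (of_int (k + e x) * T e)
       + c2 * (of_int (2 * k + e x - 1) * T (e(x := e x - 1)) + R e))
    (hderiv_at [:c0, c1, c2:] 0 x * rat_pd x Z + of_int k * (hderiv_at [:c0, c1, c2:] 1 x * Z)
       + hderiv_at [:c0, c1, c2:] 2 x * F)"
proof -
  let ?c = "\<lambda>c. Poly_Mapping.single 0 c :: mpoly"
  let ?x = "Poly_Mapping.single (Poly_Mapping.single x 1) 1 :: mpoly"
  let ?p0 = "?c c0 + ?x * (?c c1 + ?x * ?c c2)"
  let ?p1 = "?c c1 + ?x * ?c (2 * c2)"
  have hderiv: "hderiv_at [:c0, c1, c2:] 0 x = Fract ?p0 1"
    "hderiv_at [:c0, c1, c2:] 1 x = Fract ?p1 1"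
    "hderiv_at [:c0, c1, c2:] 2 x = Fract (?c c2) 1"
    by (simp_all add: hderiv_at_quadratic[unfolded One_nat_def] hderiv_at_quadratic
        rat_const_def rat_var_def)
  have k: "(of_int k :: ratfun) = Fract (?c (of_int k)) 1"
    by (cases k rule: int_cases2) (simp_all add: of_nat_fract single_uminus)
  have shift: "(\<lambda>t. e t - int (Poly_Mapping.lookup (Poly_Mapping.single x 1) t)) = e(x := e x - 1)"
    for e by (auto simp: lookup_single when_def)
  have c: "dist_mult (?c c) U e = c * U e" for c U e
    by (simp add: dist_mult_single)
  have x: "dist_mult ?x U e = U (e(x := e x - 1))" for U e
    by (simp only: dist_mult_single shift mult_1)
  have "expands (\<lambda>e. dist_mult ?p0 (pd_dist x T) e + dist_mult (?c (of_int k)) (dist_mult ?p1 T) e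
      + dist_mult (?c c2) R e)
    (Fract ?p0 1 * rat_pd x Z + Fract (?c (of_int k)) 1 * (Fract ?p1 1 * Z) + Fract (?c c2) 1 * F)"
    by (intro expands_add expands_mult expands_pd assms)
  moreover have "dist_mult ?p0 (pd_dist x T) e + dist_mult (?c (of_int k)) (dist_mult ?p1 T) e
      + dist_mult (?c c2) R e =
    c0 * (of_int (e x + 1) * T (e(x := e x + 1))) + c1 * (of_int (k + e x) * T e)
       + c2 * (of_int (2 * k + e x - 1) * T (e(x := e x - 1)) + R e)" for e
    unfolding dist_mult_add_left dist_mult_mult c x pd_dist_def by (simp add: algebra_simps)
  ultimately show ?thesis unfolding hderiv k by simp
qed

lemma mult_rho_pd_rho: "mult_rho a (pd_rho a Z) m = of_nat (m (nat \<bar>a\<bar>)) * Z m"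
  by (simp add: mult_rho_def pd_rho_def Let_def)

context genus_g_bases
begin

text \<open>
  The rational function expanded by \<open>L_1_term\<close>, written so that the summands of \<^const>\<open>D_series\<close>
  appear in it.
\<close>

definition Z_L_1 :: "(nat \<Rightarrow> 'v) \<Rightarrow> (nat \<Rightarrow> nat) \<Rightarrow> var \<Rightarrow> ratfun" where
  "Z_L_1 v m x = (case x of var.y k \<Rightarrow> Z_V V B S d g n (v(k := L V 1 (v k))) m
     | var.w a \<Rightarrow> mult_rho a (pd_var (var.w (- a)) (Z_V V B S d g n v)) m)"

lemma expands_Z_L_1:
  assumes hom: "\<And>k. k \<in> {1..n} \<Longrightarrow> v k \<in> wt_space V (h k)" and "x \<in> set X"
  shows "expands (L_1_term v m x) (Z_L_1 v m x)"
proof (cases x)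
  case (y k)
  then have "k \<in> {1..n}" using assms(2) by (auto simp: set_insertion_points)
  then have "(v(k := L V 1 (v k))) j \<in> wt_space V ((h(k := h k - 1)) j)" if "j \<in> {1..n}" for j
    using hom that wt_space_L[of "v k" "h k" 1] by auto
  from expands_Z_V[where v = "v(k := L V 1 (v k))" and h = "h(k := h k - 1)", OF this] y show ?thesis by (simp add: L_1_term_def Z_L_1_def)
next
  case (w a)
  then show ?thesis
    using expands_pd[OF expands_Z_V[where v = v and h = h, OF hom]] expands_zero
    by (simp add: L_1_term_def Z_L_1_def mult_rho_def pd_var_def Let_def)
qed

lemma genus_g_ward_identity:
  assumes hom: "\<And>k. k \<in> {1..n} \<Longrightarrow> v k \<in> wt_space V (h k)" and "degree p \<le> 2"
  shows "(\<Sum>x\<in>set X. hderiv_at p 0 x * rat_pd x (Z_V V B S d g n v m)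
     + of_int (insertion_weight h m x) * (hderiv_at p 1 x * Z_V V B S d g n v m)
     + hderiv_at p 2 x * Z_L_1 v m x) = 0" (is "?sum = 0")
proof -
  obtain c0 c1 c2 where p: "p = [:c0, c1, c2:]" using assms(2) by (rule quadratic_poly_cases)
  let ?k = "insertion_weight h m" and ?Z = "Z_series v m"
  let ?t = "\<lambda>x e. c0 * (of_int (e x + 1) * ?Z (e(x := e x + 1))) + c1 * (of_int (?k x + e x) * ?Z e)
       + c2 * (of_int (2 * ?k x + e x - 1) * ?Z (e(x := e x - 1)) + L_1_term v m x e)"
  have "expands (\<lambda>e. \<Sum>x\<in>set X. ?t x e) ?sum"
    unfolding p
    by (intro expands_sum expands_quadratic_vector_field expands_Z_V[where v = v and h = h, OF hom]
        expands_Z_L_1[where v = v and h = h, OF hom])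
  moreover have "(\<Sum>x\<in>set X. ?t x e) = 0" for e
    using ward_Z_series[where v = v and h = h and e = e and m = m, OF hom] by (simp only: sum.distrib mult_zero_right add_0 flip: sum_distrib_left)
  ultimately show ?thesis using expands_zero expands_unique by simp
qed

end

theorem proposition4p2:
  fixes V :: "'v::ab_group_add voa_data"
    and B :: "'v \<Rightarrow> 'v \<Rightarrow> complex"
    and S :: "nat \<Rightarrow> 'v set" and d :: "nat \<Rightarrow> 'v \<Rightarrow> 'v"
    and g n :: nat
    and v :: "nat \<Rightarrow> 'v" and h :: "nat \<Rightarrow> int"
    and p :: "complex poly"
  assumes "voa V" and "simple_voa V" and "strong_CFT_type V" and "self_contragredient V"
    and "invariant_form V B" and "nondegenerate B" and "B (vac V) (vac V) = 1"
    and "g \<ge> 1"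
    and "\<And>a. a \<in> {1..g} \<Longrightarrow> homogeneous_basis V (S a)"
    and "\<And>a. a \<in> {1..g} \<Longrightarrow> dual_basis B (S a) (d a)"
    and "\<And>k. k \<in> {1..n} \<Longrightarrow> v k \<in> wt_space V (h k)"
    and "degree p \<le> 2"
  shows "D_form p g n h (F_V V B S d g n v h) e m
    + (\<Sum>k\<in>{1..n}. hderiv_at p 2 (var.y k)
         * mult_dy k (F_V V B S d g n (v(k := L V 1 (v k))) (h(k := h k - 1))) e m) = 0"
proof -
  interpret genus_g_bases V B S d g n
    using assms by (simp add: genus_g_bases_def voa_form_def genus_g_bases_axioms_def voa_form_axioms_def)
  let ?Z = "Z_V V B S d g n v"
  let ?deg = "\<lambda>h k. if k \<in> {1..n} then h k else (0::int)"
  have deg: "e(k := e k - 1) = ?deg (h(k := h k - 1)) \<longleftrightarrow> e = ?deg h" if "k \<in> {1..n}" for k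
  proof -
    have "e(k := e k - 1) = ?deg (h(k := h k - 1)) \<longleftrightarrow>
        (\<forall>j. (e(k := e k - 1)) j = ?deg (h(k := h k - 1)) j)" by (simp only: fun_eq_iff)
    also have "\<dots> \<longleftrightarrow> (\<forall>j. e j = ?deg h j)"
      by (rule all_cong1) (use that in auto)
    finally show ?thesis by (simp only: fun_eq_iff)
  qed
  show ?thesis
  proof (cases "e = ?deg h")
    case True
    have F: "F_V V B S d g n v h e = ?Z"
      unfolding F_V_def by (rule if_P) (rule True)
    have F1: "mult_dy k (F_V V B S d g n (v(k := L V 1 (v k))) (h(k := h k - 1))) e m =
        Z_L_1 v m (var.y k)" if "k \<in> {1..n}" for k
    proof -
      have "e(k := e k - 1) = ?deg (h(k := h k - 1))" using True deg[OF that] by blast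
      then show ?thesis by (simp only: mult_dy_def F_V_def if_P Z_L_1_def var.case)
    qed
    have "(\<Sum>k\<in>{1..n}. hderiv_at p 2 (var.y k)
         * mult_dy k (F_V V B S d g n (v(k := L V 1 (v k))) (h(k := h k - 1))) e m) =
       (\<Sum>k\<in>{1..n}. hderiv_at p 2 (var.y k) * Z_L_1 v m (var.y k))"
      by (rule sum.cong) (simp_all only: F1)
    then show ?thesis
      using genus_g_ward_identity[where v = v and h = h and m = m, OF assms(11,12)]
      unfolding D_form_def D_series_def F mult_rho_pd_rho sum_insertion_points
      by (simp add: pd_var_def Z_L_1_def insertion_weight_def sum.distrib algebra_simps)
  next
    case False
    have "rat_pd x 0 = 0" for x
      using expands_unique[OF expands_pd[OF expands_zero, of x]] expands_zero by (simp add: pd_dist_def)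
    moreover have F: "F_V V B S d g n v h e = (\<lambda>m. 0)"
      using False by (simp only: F_V_def if_False)
    moreover have "mult_dy k (F_V V B S d g n (v(k := L V 1 (v k))) (h(k := h k - 1))) e m = 0"
      if "k \<in> {1..n}" for k
      using False deg[OF that] by (simp only: mult_dy_def F_V_def if_False)
    ultimately show ?thesis
      unfolding D_form_def D_series_def F mult_rho_pd_rho
      by (simp add: pd_var_def mult_rho_def)
  qed
qed

end
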